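(* Let $Z$ be a central ideal of a triassociative algebra $L$ over a field $\mathbb{F}$, with natural central extension $0\to Z\to L\xrightarrow{\beta}L/Z\to0$ and a section $\mu$ of $\beta$, and let $A$ be a central $L$-module. Then the sequence $$0\to\mathrm{Hom}(L/Z,A)\xrightarrow{\mathrm{Inf}_1}\mathrm{Hom}(L,A)\xrightarrow{\mathrm{Res}}\mathrm{Hom}(Z,A)\xrightarrow{\mathrm{Tra}}\mathcal{H}^2(L/Z,A)\xrightarrow{\mathrm{Inf}_2}\mathcal{H}^2(L,A)$$ is exact.
   Context: Fix a field $\mathbb{F}$. A triassociative algebra is an $\mathbb{F}$-vector space $L$ with three bilinear products $\vdash,\dashv,\perp:L\times L\to L$ satisfying, for all $x,y,z\in L$: $(x\vdash y)\vdash z=x\vdash(y\vdash z)$; $(x\dashv y)\dashv z=x\dashv(y\dashv z)$; $(x\dashv y)\vdash z=x\vdash(y\vdash z)$; $(x\dashv y)\dashv z=x\dashv(y\vdash z)$; $(x\vdash y)\dashv z=x\vdash(y\dashv z)$; $(x\perp y)\vdash z=x\vdash(y\vdash z)$; $(x\dashv y)\dashv z=x\dashv(y\perp z)$; $(x\vdash y)\perp z=x\vdash(y\perp z)$; $(x\perp y)\dashv z=x\perp(y\dashv z)$; $(x\dashv y)\perp z=x\perp(y\vdash z)$; $(x\perp y)\perp z=x\perp(y\perp z)$. Homomorphisms are linear maps preserving all three products; ideals and quotients are defined in the usual way. The center $Z(L)$ is the set of all $z\in L$ with $z*x=x*z=0$ for all $x\in L$ and $*\in\{\vdash,\dashv,\perp\}$;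 a central ideal is an ideal contained in $Z(L)$. A central $L$-module $A$ is an $\mathbb{F}$-vector space with trivial $L$-actions, regarded as a triassociative algebra with all products zero; $\mathrm{Hom}(-,A)$ denotes the space of triassociative algebra homomorphisms to $A$. A section of $\beta$ is a linear map $\mu:L/Z\to L$ with $\beta\circ\mu=\mathrm{id}$. Cohomology: for a triassociative algebra $B$, $\mathcal{Z}^2(B,A)$ is the space of triples $(f_\vdash,f_\dashv,f_\perp)$ of bilinear maps $B\times B\to A$ such that for all $x,y,z\in B$: $f_\vdash(x\vdash y,z)=f_\vdash(x,y\vdash z)$; $f_\dashv(x\dashv y,z)=f_\dashv(x,y\dashv z)$; $f_\vdash(x\dashv y,z)=f_\vdash(x,y\vdash z)$; $f_\dashv(x\dashv y,z)=f_\dashv(x,y\vdash z)$; $f_\dashv(x\vdash y,z)=f_\vdash(x,y\dashv z)$; $f_\vdash(x\perp y,z)=f_\vdash(x,y\vdash z)$; $f_\dashv(x\dashv y,z)=f_\dashv(x,y\perp z)$; $f_\perp(x\vdash y,z)=f_\vdash(x,y\perp z)$; $f_\dashv(x\perp y,z)=f_\perp(x,y\dashv z)$; $f_\perp(x\dashv y,z)=f_\perp(x,y\vdash z)$; $f_\perp(x\perp y,z)=f_\perp(x,y\perp z)$. $\mathcal{B}^2(B,A)$ is the subspace of triples with $f_*(x,y)=-\varepsilon(x*y)$ for all $x,y\in B$ and all $*\in\{\vdash,\dashv,\perp\}$, for some linear $\varepsilon:B\to A$. $\mathcal{H}^2(B,A)=\mathcal{Z}^2(B,A)/\mathcal{B}^2(B,A)$.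 Maps: $\mathrm{Inf}_1(\chi)=\chi\circ\beta$; $\mathrm{Res}(\pi)=\pi\circ\iota$ with $\iota:Z\to L$ the inclusion; $\mathrm{Tra}(\chi)$ is the class of $(\chi\circ f_\vdash,\chi\circ f_\dashv,\chi\circ f_\perp)$, where $f_*:L/Z\times L/Z\to Z$ is $f_*(\overline{x},\overline{y})=\mu(\overline{x})*\mu(\overline{y})-\mu(\overline{x}*\overline{y})$ for $*\in\{\vdash,\dashv,\perp\}$ (the class does not depend on the choice of $\mu$); $\mathrm{Inf}_2$ sends the class of $(f_\vdash,f_\dashv,f_\perp)\in\mathcal{Z}^2(L/Z,A)$ to the class of $(f'_\vdash,f'_\dashv,f'_\perp)$ with $f'_*(x,y)=f_*(\beta(x),\beta(y))$ for $x,y\in L$. *)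

theory Defs
  imports "HOL-Algebra.Module" "HOL-Algebra.QuotRing"
begin

text \<open>
  Vector spaces over a field \<open>F\<close> are modules over \<open>F\<close> in the sense of \<^locale>\<open>module\<close>.  The
  record \<open>('f, 'v) module\<close> inherits fields \<open>mult\<close> and \<open>one\<close> that this locale never
  constrains; they are \<^const>\<open>undefined\<close> in the spaces built below.
\<close>

locale linear_map = V?: module F V + W?: module F W
  for F :: "('f, 'k) ring_scheme" and V :: "('f, 'v, 'm) module_scheme"
    and W :: "('f, 'w, 'n) module_scheme" and h :: "'v \<Rightarrow> 'w" +
  assumes map_closed: "h \<in> carrier V \<rightarrow> carrier W"
    and map_add: "\<lbrakk>x \<in> carrier V; y \<in> carrier V\<rbrakk> \<Longrightarrow> h (x \<oplus>\<^bsub>V\<^esub> y) = h x \<oplus>\<^bsub>W\<^esub> h y"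
    and map_smult: "\<lbrakk>a \<in> carrier F; x \<in> carrier V\<rbrakk> \<Longrightarrow> h (a \<odot>\<^bsub>V\<^esub> x) = a \<odot>\<^bsub>W\<^esub> h x"

definition bilinear_map ::
  "('f, 'k) ring_scheme \<Rightarrow> ('f, 'v, 'm) module_scheme \<Rightarrow> ('f, 'w, 'n) module_scheme
    \<Rightarrow> ('v \<Rightarrow> 'v \<Rightarrow> 'w) \<Rightarrow> bool" where
  "bilinear_map F V W f \<longleftrightarrow>
     (\<forall>x\<in>carrier V. linear_map F V W (\<lambda>y. f x y)) \<and>
     (\<forall>y\<in>carrier V. linear_map F V W (\<lambda>x. f x y))"

definition quotient_space :: "('f, 'v, 'm) module_scheme \<Rightarrow> 'v set \<Rightarrow> ('f, 'v set) module" where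
  "quotient_space V U =
     \<lparr>carrier = a_rcosets\<^bsub>V\<^esub> U, mult = undefined, one = undefined,
      zero = U, add = set_add V, smult = (\<lambda>a X. \<Union>x\<in>X. U +>\<^bsub>V\<^esub> (a \<odot>\<^bsub>V\<^esub> x))\<rparr>"

definition zero_space :: "('f, unit) module" where
  "zero_space =
     \<lparr>carrier = {()}, mult = undefined, one = undefined,
      zero = (), add = (\<lambda>_ _. ()), smult = (\<lambda>_ _. ())\<rparr>"

definition exact_at ::
  "('f, 'k) ring_scheme \<Rightarrow> ('f, 'u, 'l) module_scheme \<Rightarrow> ('u \<Rightarrow> 'v)
    \<Rightarrow> ('f, 'v, 'm) module_scheme \<Rightarrow> ('v \<Rightarrow> 'w) \<Rightarrow> ('f, 'w, 'n) module_scheme \<Rightarrow> bool" where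
  "exact_at F U f V g W \<longleftrightarrow>
     linear_map F U V f \<and> linear_map F V W g \<and> f ` carrier U = a_kernel V W g"


section \<open>Triassociative algebras\<close>

datatype triop = Vdash | Dashv | Perp

record ('f, 'v) triass = "('f, 'v) module" +
  triprod :: "triop \<Rightarrow> 'v \<Rightarrow> 'v \<Rightarrow> 'v"

no_notation bottom (\<open>\<bottom>\<index>\<close>)

abbreviation vdash_prod :: "('f, 'v, 'm) triass_scheme \<Rightarrow> 'v \<Rightarrow> 'v \<Rightarrow> 'v" (infixl \<open>\<turnstile>\<index>\<close> 70)
  where "x \<turnstile>\<^bsub>L\<^esub> y \<equiv> triprod L Vdash x y"
abbreviation dashv_prod :: "('f, 'v, 'm) triass_scheme \<Rightarrow> 'v \<Rightarrow> 'v \<Rightarrow> 'v" (infixl \<open>\<stileturn>\<index>\<close> 70)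
  where "x \<stileturn>\<^bsub>L\<^esub> y \<equiv> triprod L Dashv x y"
abbreviation perp_prod :: "('f, 'v, 'm) triass_scheme \<Rightarrow> 'v \<Rightarrow> 'v \<Rightarrow> 'v" (infixl \<open>\<bottom>\<index>\<close> 70)
  where "x \<bottom>\<^bsub>L\<^esub> y \<equiv> triprod L Perp x y"

locale triassociative_algebra = field F + L?: module F L
  for F :: "('f, 'k) ring_scheme" and L :: "('f, 'v, 'm) triass_scheme" (structure) +
  assumes bilinear: "bilinear_map F L L (triprod L p)"
    and triass:
      "\<lbrakk>x \<in> carrier L; y \<in> carrier L; z \<in> carrier L\<rbrakk> \<Longrightarrow> (x \<turnstile> y) \<turnstile> z = x \<turnstile> (y \<turnstile> z)"
      "\<lbrakk>x \<in> carrier L; y \<in> carrier L; z \<in> carrier L\<rbrakk> \<Longrightarrow> (x \<stileturn> y) \<stileturn> z = x \<stileturn> (y \<stileturn> z)"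
      "\<lbrakk>x \<in> carrier L; y \<in> carrier L; z \<in> carrier L\<rbrakk> \<Longrightarrow> (x \<stileturn> y) \<turnstile> z = x \<turnstile> (y \<turnstile> z)"
      "\<lbrakk>x \<in> carrier L; y \<in> carrier L; z \<in> carrier L\<rbrakk> \<Longrightarrow> (x \<stileturn> y) \<stileturn> z = x \<stileturn> (y \<turnstile> z)"
      "\<lbrakk>x \<in> carrier L; y \<in> carrier L; z \<in> carrier L\<rbrakk> \<Longrightarrow> (x \<turnstile> y) \<stileturn> z = x \<turnstile> (y \<stileturn> z)"
      "\<lbrakk>x \<in> carrier L; y \<in> carrier L; z \<in> carrier L\<rbrakk> \<Longrightarrow> (x \<bottom> y) \<turnstile> z = x \<turnstile> (y \<turnstile> z)"
      "\<lbrakk>x \<in> carrier L; y \<in> carrier L; z \<in> carrier L\<rbrakk> \<Longrightarrow> (x \<stileturn> y) \<stileturn> z = x \<stileturn> (y \<bottom> z)"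
      "\<lbrakk>x \<in> carrier L; y \<in> carrier L; z \<in> carrier L\<rbrakk> \<Longrightarrow> (x \<turnstile> y) \<bottom> z = x \<turnstile> (y \<bottom> z)"
      "\<lbrakk>x \<in> carrier L; y \<in> carrier L; z \<in> carrier L\<rbrakk> \<Longrightarrow> (x \<bottom> y) \<stileturn> z = x \<bottom> (y \<stileturn> z)"
      "\<lbrakk>x \<in> carrier L; y \<in> carrier L; z \<in> carrier L\<rbrakk> \<Longrightarrow> (x \<stileturn> y) \<bottom> z = x \<bottom> (y \<turnstile> z)"
      "\<lbrakk>x \<in> carrier L; y \<in> carrier L; z \<in> carrier L\<rbrakk> \<Longrightarrow> (x \<bottom> y) \<bottom> z = x \<bottom> (y \<bottom> z)"

definition triass_ideal :: "('f, 'k) ring_scheme \<Rightarrow> ('f, 'v) triass \<Rightarrow> 'v set \<Rightarrow> bool" where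
  "triass_ideal F L I \<longleftrightarrow> submodule I F L \<and>
     (\<forall>p. \<forall>x\<in>carrier L. \<forall>z\<in>I. triprod L p x z \<in> I \<and> triprod L p z x \<in> I)"

definition triass_center :: "('f, 'v) triass \<Rightarrow> 'v set" where
  "triass_center L = {z \<in> carrier L. \<forall>p. \<forall>x\<in>carrier L.
     triprod L p z x = \<zero>\<^bsub>L\<^esub> \<and> triprod L p x z = \<zero>\<^bsub>L\<^esub>}"

definition central_ideal :: "('f, 'k) ring_scheme \<Rightarrow> ('f, 'v) triass \<Rightarrow> 'v set \<Rightarrow> bool" where
  "central_ideal F L Z \<longleftrightarrow> triass_ideal F L Z \<and> Z \<subseteq> triass_center L"

definition triass_quotient :: "('f, 'v) triass \<Rightarrow> 'v set \<Rightarrow> ('f, 'v set) triass" where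
  "triass_quotient L I = module.extend (quotient_space L I)
     (triass.fields (\<lambda>p X Y. \<Union>x\<in>X. \<Union>y\<in>Y. I +>\<^bsub>L\<^esub> triprod L p x y))"

text \<open>
  The actions on a central module are trivial, so it is given by its underlying vector
  space \<open>A\<close>, which becomes a triassociative algebra with zero products.
\<close>

definition trivial_triass :: "('f, 'a) module \<Rightarrow> ('f, 'a) triass" where
  "trivial_triass A = module.extend A (triass.fields (\<lambda>p x y. \<zero>\<^bsub>A\<^esub>))"

definition natural_map :: "('f, 'v) triass \<Rightarrow> 'v set \<Rightarrow> 'v \<Rightarrow> 'v set" where
  "natural_map L Z x = Z +>\<^bsub>L\<^esub> x"

definition is_section ::
  "('f, 'k) ring_scheme \<Rightarrow> ('f, 'v) triass \<Rightarrow> 'v set \<Rightarrow> ('v set \<Rightarrow> 'v) \<Rightarrow> bool" where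
  "is_section F L Z \<mu> \<longleftrightarrow> linear_map F (triass_quotient L Z) L \<mu> \<and>
     (\<forall>X\<in>carrier (triass_quotient L Z). natural_map L Z (\<mu> X) = X)"


section \<open>Homomorphisms and second cohomology\<close>

text \<open>
  Homomorphisms and cochains are taken extensional (\<^const>\<open>undefined\<close> off the carrier), so that
  equality of HOL functions is equality of maps on the carrier.
\<close>

definition triass_hom ::
  "('f, 'k) ring_scheme \<Rightarrow> ('f, 'b) triass \<Rightarrow> ('f, 'c) triass \<Rightarrow> ('b \<Rightarrow> 'c) set" where
  "triass_hom F B C = {h \<in> extensional (carrier B). linear_map F B C h \<and>
     (\<forall>p. \<forall>x\<in>carrier B. \<forall>y\<in>carrier B. h (triprod B p x y) = triprod C p (h x) (h y))}"

definition Hom_space ::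
  "('f, 'k) ring_scheme \<Rightarrow> ('f, 'b) triass \<Rightarrow> ('f, 'a) module \<Rightarrow> ('f, 'b \<Rightarrow> 'a) module" where
  "Hom_space F B A =
     \<lparr>carrier = triass_hom F B (trivial_triass A), mult = undefined, one = undefined,
      zero = (\<lambda>x\<in>carrier B. \<zero>\<^bsub>A\<^esub>),
      add = (\<lambda>g h. \<lambda>x\<in>carrier B. g x \<oplus>\<^bsub>A\<^esub> h x),
      smult = (\<lambda>a h. \<lambda>x\<in>carrier B. a \<odot>\<^bsub>A\<^esub> h x)\<rparr>"

text \<open>A triple \<open>(f\<^sub>\<turnstile>, f\<^sub>\<stileturn>, f\<^sub>\<bottom>)\<close> is a function on \<^typ>\<open>triop\<close>.\<close>

definition cocycles ::
  "('f, 'k) ring_scheme \<Rightarrow> ('f, 'b) triass \<Rightarrow> ('f, 'a) module \<Rightarrow> (triop \<Rightarrow> 'b \<Rightarrow> 'b \<Rightarrow> 'a) set" where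
  "cocycles F B A = {f.
     (\<forall>p. f p \<in> carrier B \<rightarrow>\<^sub>E carrier B \<rightarrow>\<^sub>E carrier A) \<and>
     (\<forall>p. bilinear_map F B A (f p)) \<and>
     (\<forall>x\<in>carrier B. \<forall>y\<in>carrier B. \<forall>z\<in>carrier B.
        f Vdash (x \<turnstile>\<^bsub>B\<^esub> y) z = f Vdash x (y \<turnstile>\<^bsub>B\<^esub> z) \<and>
        f Dashv (x \<stileturn>\<^bsub>B\<^esub> y) z = f Dashv x (y \<stileturn>\<^bsub>B\<^esub> z) \<and>
        f Vdash (x \<stileturn>\<^bsub>B\<^esub> y) z = f Vdash x (y \<turnstile>\<^bsub>B\<^esub> z) \<and>
        f Dashv (x \<stileturn>\<^bsub>B\<^esub> y) z = f Dashv x (y \<turnstile>\<^bsub>B\<^esub> z) \<and>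
        f Dashv (x \<turnstile>\<^bsub>B\<^esub> y) z = f Vdash x (y \<stileturn>\<^bsub>B\<^esub> z) \<and>
        f Vdash (x \<bottom>\<^bsub>B\<^esub> y) z = f Vdash x (y \<turnstile>\<^bsub>B\<^esub> z) \<and>
        f Dashv (x \<stileturn>\<^bsub>B\<^esub> y) z = f Dashv x (y \<bottom>\<^bsub>B\<^esub> z) \<and>
        f Perp (x \<turnstile>\<^bsub>B\<^esub> y) z = f Vdash x (y \<bottom>\<^bsub>B\<^esub> z) \<and>
        f Dashv (x \<bottom>\<^bsub>B\<^esub> y) z = f Perp x (y \<stileturn>\<^bsub>B\<^esub> z) \<and>
        f Perp (x \<stileturn>\<^bsub>B\<^esub> y) z = f Perp x (y \<turnstile>\<^bsub>B\<^esub> z) \<and>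
        f Perp (x \<bottom>\<^bsub>B\<^esub> y) z = f Perp x (y \<bottom>\<^bsub>B\<^esub> z))}"

definition Z2 ::
  "('f, 'k) ring_scheme \<Rightarrow> ('f, 'b) triass \<Rightarrow> ('f, 'a) module
    \<Rightarrow> ('f, triop \<Rightarrow> 'b \<Rightarrow> 'b \<Rightarrow> 'a) module" where
  "Z2 F B A =
     \<lparr>carrier = cocycles F B A, mult = undefined, one = undefined,
      zero = (\<lambda>p. \<lambda>x\<in>carrier B. \<lambda>y\<in>carrier B. \<zero>\<^bsub>A\<^esub>),
      add = (\<lambda>f g p. \<lambda>x\<in>carrier B. \<lambda>y\<in>carrier B. f p x y \<oplus>\<^bsub>A\<^esub> g p x y),
      smult = (\<lambda>a f p. \<lambda>x\<in>carrier B. \<lambda>y\<in>carrier B. a \<odot>\<^bsub>A\<^esub> f p x y)\<rparr>"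

definition B2 ::
  "('f, 'k) ring_scheme \<Rightarrow> ('f, 'b) triass \<Rightarrow> ('f, 'a) module \<Rightarrow> (triop \<Rightarrow> 'b \<Rightarrow> 'b \<Rightarrow> 'a) set" where
  "B2 F B A = {\<lambda>p. \<lambda>x\<in>carrier B. \<lambda>y\<in>carrier B. \<ominus>\<^bsub>A\<^esub> \<epsilon> (triprod B p x y) | \<epsilon>. linear_map F B A \<epsilon>}"

definition H2 ::
  "('f, 'k) ring_scheme \<Rightarrow> ('f, 'b) triass \<Rightarrow> ('f, 'a) module
    \<Rightarrow> ('f, (triop \<Rightarrow> 'b \<Rightarrow> 'b \<Rightarrow> 'a) set) module" where
  "H2 F B A = quotient_space (Z2 F B A) (B2 F B A)"

definition cohomology_class ::
  "('f, 'k) ring_scheme \<Rightarrow> ('f, 'b) triass \<Rightarrow> ('f, 'a) module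
    \<Rightarrow> (triop \<Rightarrow> 'b \<Rightarrow> 'b \<Rightarrow> 'a) \<Rightarrow> (triop \<Rightarrow> 'b \<Rightarrow> 'b \<Rightarrow> 'a) set" where
  "cohomology_class F B A f = B2 F B A +>\<^bsub>Z2 F B A\<^esub> f"


section \<open>The maps of the sequence\<close>

definition Inf1 :: "('f, 'v) triass \<Rightarrow> 'v set \<Rightarrow> ('v set \<Rightarrow> 'a) \<Rightarrow> 'v \<Rightarrow> 'a" where
  "Inf1 L Z \<chi> = compose (carrier L) \<chi> (natural_map L Z)"

definition Res :: "'v set \<Rightarrow> ('v \<Rightarrow> 'a) \<Rightarrow> 'v \<Rightarrow> 'a" where
  "Res Z \<pi> = restrict \<pi> Z"

definition section_cocycle ::
  "('f, 'v) triass \<Rightarrow> 'v set \<Rightarrow> ('v set \<Rightarrow> 'v) \<Rightarrow> triop \<Rightarrow> 'v set \<Rightarrow> 'v set \<Rightarrow> 'v" where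
  "section_cocycle L Z \<mu> p X Y =
     triprod L p (\<mu> X) (\<mu> Y) \<ominus>\<^bsub>L\<^esub> \<mu> (triprod (triass_quotient L Z) p X Y)"

definition Tra ::
  "('f, 'k) ring_scheme \<Rightarrow> ('f, 'v) triass \<Rightarrow> 'v set \<Rightarrow> ('v set \<Rightarrow> 'v) \<Rightarrow> ('f, 'a) module
    \<Rightarrow> ('v \<Rightarrow> 'a) \<Rightarrow> (triop \<Rightarrow> 'v set \<Rightarrow> 'v set \<Rightarrow> 'a) set" where
  "Tra F L Z \<mu> A \<chi> = cohomology_class F (triass_quotient L Z) A
     (\<lambda>p. \<lambda>X\<in>carrier (triass_quotient L Z). \<lambda>Y\<in>carrier (triass_quotient L Z).
        \<chi> (section_cocycle L Z \<mu> p X Y))"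

text \<open>
  The union over all representatives is the common class of their inflations once the
  latter is independent of the representative, as with \<^const>\<open>rcoset_mult\<close>.
\<close>

definition Inf2 ::
  "('f, 'k) ring_scheme \<Rightarrow> ('f, 'v) triass \<Rightarrow> 'v set \<Rightarrow> ('f, 'a) module
    \<Rightarrow> (triop \<Rightarrow> 'v set \<Rightarrow> 'v set \<Rightarrow> 'a) set \<Rightarrow> (triop \<Rightarrow> 'v \<Rightarrow> 'v \<Rightarrow> 'a) set" where
  "Inf2 F L Z A C = (\<Union>f\<in>C. cohomology_class F L A
     (\<lambda>p. \<lambda>x\<in>carrier L. \<lambda>y\<in>carrier L. f p (natural_map L Z x) (natural_map L Z y)))"

end

theory Submission
  imports Defs
begin

text \<open>
  Everything rests on the retraction \<open>\<rho> x = x - \<mu> (\<beta> x)\<close> of \<open>L\<close> onto \<open>Z\<close>.  As \<open>Z\<close> is central,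
  \<open>\<mu> (\<beta> x) * \<mu> (\<beta> y) = x * y\<close>, so the section cocycle is \<open>f (\<beta> x) (\<beta> y) = \<rho> (x * y)\<close>; its
  cocycle identities are thus the axioms of \<open>L\<close>, and every exactness witness is explicit:
  \<open>\<pi> \<circ> \<mu>\<close> descends a \<open>\<pi>\<close> vanishing on \<open>Z\<close>; if \<open>\<chi> \<circ> f\<close> is the coboundary of \<open>\<epsilon>\<close> then
  \<open>\<chi> \<circ> \<rho> + \<epsilon> \<circ> \<beta>\<close> extends \<open>\<chi>\<close> to \<open>L\<close>; and if the inflation of \<open>g\<close> is the coboundary of \<open>\<epsilon>\<close>
  then \<open>g\<close> represents the transgression of \<open>-\<epsilon>\<close> restricted to \<open>Z\<close>.
\<close>

section \<open>Linear maps and quotient spaces\<close>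

lemma (in abelian_group) minus_eq_zero_iff:
  assumes "x \<in> carrier G" "y \<in> carrier G"
  shows "x \<ominus> y = \<zero> \<longleftrightarrow> x = y"
proof
  assume "x \<ominus> y = \<zero>"
  then have "x = \<ominus> (\<ominus> y)"
    using assms minus_equality[of x "\<ominus> y"] by (simp add: a_minus_def)
  then show "x = y"
    using assms by simp
qed (simp add: assms a_minus_def r_neg)

lemma (in abelian_group) neg_zero: "\<ominus> \<zero> = \<zero>"
  by (rule minus_equality) simp_all

lemma linear_mapI:
  assumes "module F V" "module F W"
    and "\<And>x. x \<in> carrier V \<Longrightarrow> h x \<in> carrier W"
    and "\<And>x y. \<lbrakk>x \<in> carrier V; y \<in> carrier V\<rbrakk> \<Longrightarrow> h (x \<oplus>\<^bsub>V\<^esub> y) = h x \<oplus>\<^bsub>W\<^esub> h y"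
    and "\<And>a x. \<lbrakk>a \<in> carrier F; x \<in> carrier V\<rbrakk> \<Longrightarrow> h (a \<odot>\<^bsub>V\<^esub> x) = a \<odot>\<^bsub>W\<^esub> h x"
  shows "linear_map F V W h"
  using assms by (simp add: linear_map_def linear_map_axioms_def)

context linear_map
begin

lemma closed [simp, intro]: "x \<in> carrier V \<Longrightarrow> h x \<in> carrier W"
  using map_closed by blast

lemma modules: "module F V" "module F W"
  by (rule V.module_axioms, rule W.module_axioms)

text \<open>Additivity alone makes \<open>h\<close> a homomorphism of the additive groups, so the
  library facts on zero and negatives apply to every linear map.\<close>

sublocale hom: abelian_group_hom V W h
proof -
  have "group_hom (add_monoid V) (add_monoid W) h"
    using V.M.a_group W.M.a_group
    by (intro group_hom.intro group_hom_axioms.intro) (auto simp: hom_def map_add)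
  then show "abelian_group_hom V W h"
    by (intro abelian_group_homI V.M.abelian_group_axioms W.M.abelian_group_axioms)
qed

lemma map_zero: "h \<zero>\<^bsub>V\<^esub> = \<zero>\<^bsub>W\<^esub>"
  by (rule hom.hom_zero)

lemma map_minus:
  "\<lbrakk>x \<in> carrier V; y \<in> carrier V\<rbrakk> \<Longrightarrow> h (x \<ominus>\<^bsub>V\<^esub> y) = h x \<ominus>\<^bsub>W\<^esub> h y"
  by (simp add: a_minus_def map_add)

end

section \<open>Composites and linear combinations of linear maps\<close>

lemma linear_map_cong:
  assumes "linear_map F V W h" "\<And>x. x \<in> carrier V \<Longrightarrow> g x = h x"
  shows "linear_map F V W g"
proof -
  interpret linear_map F V W h by fact
  show ?thesis
    by (rule linear_mapI) (simp_all add: modules assms(2) map_add map_smult)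
qed

lemma linear_map_comp:
  assumes "linear_map F U V g" "linear_map F V W h"
  shows "linear_map F U W (\<lambda>x. h (g x))"
proof -
  interpret g: linear_map F U V g by fact
  interpret h: linear_map F V W h by fact
  show ?thesis
    by (rule linear_mapI)
      (simp_all add: g.modules h.modules g.map_add h.map_add g.map_smult h.map_smult)
qed

lemma linear_map_id: "module F V \<Longrightarrow> linear_map F V V (\<lambda>x. x)"
  by (rule linear_mapI) auto

lemma linear_map_zero:
  assumes "module F V" "module F W"
  shows "linear_map F V W (\<lambda>_. \<zero>\<^bsub>W\<^esub>)"
proof -
  interpret V: module F V by fact
  interpret W: module F W by fact
  show ?thesis by (rule linear_mapI) (simp_all add: assms)
qed

lemma linear_map_add:
  assumes "linear_map F V W g" "linear_map F V W h"
  shows "linear_map F V W (\<lambda>x. g x \<oplus>\<^bsub>W\<^esub> h x)"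
proof -
  interpret g: linear_map F V W g by fact
  interpret h: linear_map F V W h by fact
  show ?thesis
    by (rule linear_mapI)
      (simp_all add: g.modules g.map_add h.map_add g.map_smult h.map_smult
        g.W.M.a_ac g.W.smult_r_distr)
qed

text \<open>Homogeneity rests on the commutativity of \<open>F\<close>: \<open>smult_assoc1\<close>,
  read backwards, merges the two scalars into one product, and \<open>m_comm\<close> swaps
  them.\<close>

lemma linear_map_smult:
  assumes "a \<in> carrier F" "linear_map F V W h"
  shows "linear_map F V W (\<lambda>x. a \<odot>\<^bsub>W\<^esub> h x)"
proof -
  interpret linear_map F V W h by fact
  show ?thesis
    by (rule linear_mapI)
      (simp_all add: modules assms(1) map_add map_smult W.smult_r_distr V.R.m_comm
        flip: W.smult_assoc1)
qed

lemma linear_map_neg: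
  assumes "linear_map F V W h"
  shows "linear_map F V W (\<lambda>x. \<ominus>\<^bsub>W\<^esub> h x)"
proof -
  interpret linear_map F V W h by fact
  show ?thesis
    by (rule linear_mapI)
      (simp_all add: modules map_add map_smult W.M.minus_add W.smult_r_minus)
qed

lemma linear_map_minus:
  assumes "linear_map F V W g" "linear_map F V W h"
  shows "linear_map F V W (\<lambda>x. g x \<ominus>\<^bsub>W\<^esub> h x)"
  unfolding a_minus_def by (intro linear_map_add linear_map_neg assms)

text \<open>The \<open>module\<close> axioms see only the carrier, zero, addition and scalar
  multiplication. Records agreeing there may have different extensions, so module facts pass from a
  vector space to the algebra record built over it.\<close>

lemma module_cong:
  assumes "module F V" "carrier V' = carrier V" "zero V' = zero V" "add V' = add V"
    "smult V' = smult V"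
  shows "module F V'"
proof -
  interpret V: module F V by fact
  have "abelian_group V'"
    using V.M.l_neg
    by (intro abelian_groupI) (auto simp: assms(2-5) V.M.a_ac intro!: bexI[OF _ V.M.a_inv_closed])
  then show ?thesis
    by (intro moduleI V.R.is_cring)
      (simp_all add: assms(2-5) V.smult_l_distr V.smult_r_distr V.smult_assoc1)
qed

lemma linear_map_cong_spaces:
  assumes "linear_map F V W h"
    and "carrier V' = carrier V" "zero V' = zero V" "add V' = add V" "smult V' = smult V"
    and "carrier W' = carrier W" "zero W' = zero W" "add W' = add W" "smult W' = smult W"
  shows "linear_map F V' W' h"
proof -
  interpret linear_map F V W h by fact
  show ?thesis
    by (rule linear_mapI)
      (simp_all add: assms(2-) map_add map_smult
        module_cong[OF modules(1)] module_cong[OF modules(2)])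
qed

lemma linear_map_subspace_codomain:
  assumes "linear_map F V W h" "submodule S F W" "\<And>x. x \<in> carrier V \<Longrightarrow> h x \<in> S"
  shows "linear_map F V (W\<lparr>carrier := S\<rparr>) h"
proof -
  interpret linear_map F V W h by fact
  show ?thesis
    using submodule.submodule_is_module[OF assms(2)]
    by (intro linear_mapI) (simp_all add: modules assms(3) map_add map_smult)
qed

lemma linear_map_subspace_domain:
  assumes "linear_map F V W h" "submodule S F V"
  shows "linear_map F (V\<lparr>carrier := S\<rparr>) W h"
proof -
  interpret linear_map F V W h by fact
  have "S \<subseteq> carrier V"
    using V.submoduleE(1)[OF assms(2)] .
  then show ?thesis
    using submodule.submodule_is_module[OF assms(2)]
    by (intro linear_mapI) (simp_all add: modules map_add map_smult subset_iff)
qed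

section \<open>Quotients of a module by a submodule\<close>

locale quotient_module = V?: module F V for F V and U :: "'v set" +
  assumes submodule: "submodule U F V"
begin

lemma abelian_subgroup: "abelian_subgroup U V"
  by (intro abelian_subgroupI3 additive_subgroup.intro V.M.abelian_group_axioms
      submodule.axioms(1)[OF submodule])

sublocale U: abelian_subgroup U V
  by (rule abelian_subgroup)

lemma mem_coset_iff:
  "\<lbrakk>x \<in> carrier V; y \<in> carrier V\<rbrakk> \<Longrightarrow> x \<in> U +>\<^bsub>V\<^esub> y \<longleftrightarrow> x \<ominus>\<^bsub>V\<^esub> y \<in> U"
  using U.a_rcos_module[of y x] by (simp add: a_minus_def)

lemma coset_eq_iff:
  "\<lbrakk>x \<in> carrier V; y \<in> carrier V\<rbrakk> \<Longrightarrow> U +>\<^bsub>V\<^esub> x = U +>\<^bsub>V\<^esub> y \<longleftrightarrow> x \<ominus>\<^bsub>V\<^esub> y \<in> U"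
  using mem_coset_iff[of x y] U.a_repr_independence'[of x y] U.a_rcos_self[of x] by auto

lemma coset_subset: "x \<in> carrier V \<Longrightarrow> U +>\<^bsub>V\<^esub> x \<subseteq> carrier V"
  using U.a_elemrcos_carrier by blast

lemma carrier_quotient_space:
  "carrier (quotient_space V U) = (\<lambda>x. U +>\<^bsub>V\<^esub> x) ` carrier V"
  by (auto simp: quotient_space_def A_RCOSETS_def')

text \<open>Writing the zero \<open>U\<close> as a coset puts it in the form that the rules for the
  other operations expect.\<close>

lemma zero_quotient_space: "\<zero>\<^bsub>quotient_space V U\<^esub> = U +>\<^bsub>V\<^esub> \<zero>\<^bsub>V\<^esub>"
  by (simp add: quotient_space_def U.a_subset)

lemma add_quotient_space:
  "\<lbrakk>x \<in> carrier V; y \<in> carrier V\<rbrakk> \<Longrightarrow>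
    (U +>\<^bsub>V\<^esub> x) \<oplus>\<^bsub>quotient_space V U\<^esub> (U +>\<^bsub>V\<^esub> y) = U +>\<^bsub>V\<^esub> (x \<oplus>\<^bsub>V\<^esub> y)"
  by (simp add: quotient_space_def U.a_rcos_sum)

text \<open>Operations and maps on cosets are defined as unions over representatives. A coset is
  nonempty, so a union whose members all agree collapses to the value at \<open>x\<close>.\<close>

lemma UN_coset_const:
  assumes "x \<in> carrier V" "\<And>y. y \<in> U +>\<^bsub>V\<^esub> x \<Longrightarrow> g y = g x"
  shows "(\<Union>y\<in>U +>\<^bsub>V\<^esub> x. g y) = g x"
  using assms(2) U.a_rcos_self[OF assms(1)] by blast

lemma smult_quotient_space:
  assumes "a \<in> carrier F" "x \<in> carrier V"
  shows "a \<odot>\<^bsub>quotient_space V U\<^esub> (U +>\<^bsub>V\<^esub> x) = U +>\<^bsub>V\<^esub> (a \<odot>\<^bsub>V\<^esub> x)"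
proof -
  have "U +>\<^bsub>V\<^esub> (a \<odot>\<^bsub>V\<^esub> y) = U +>\<^bsub>V\<^esub> (a \<odot>\<^bsub>V\<^esub> x)" if "y \<in> U +>\<^bsub>V\<^esub> x" for y
  proof -
    have y: "y \<in> carrier V"
      using that coset_subset assms(2) by blast
    then have "y \<ominus>\<^bsub>V\<^esub> x \<in> U"
      using that mem_coset_iff assms(2) by blast
    then have "a \<odot>\<^bsub>V\<^esub> (y \<ominus>\<^bsub>V\<^esub> x) \<in> U"
      by (rule submodule.smult_closed[OF submodule assms(1)])
    then show ?thesis
      using assms y by (simp add: coset_eq_iff a_minus_def V.smult_r_distr V.smult_r_minus)
  qed
  then show ?thesis
    using UN_coset_const[OF assms(2), of "\<lambda>y. U +>\<^bsub>V\<^esub> (a \<odot>\<^bsub>V\<^esub> y)"]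
    by (simp add: quotient_space_def)
qed

lemma abelian_group_quotient_space: "abelian_group (quotient_space V U)"
proof (rule abelian_groupI)
  fix X assume "X \<in> carrier (quotient_space V U)"
  then obtain x where x: "x \<in> carrier V" and X: "X = U +>\<^bsub>V\<^esub> x"
    by (auto simp: carrier_quotient_space)
  have "(U +>\<^bsub>V\<^esub> (\<ominus>\<^bsub>V\<^esub> x)) \<oplus>\<^bsub>quotient_space V U\<^esub> X = \<zero>\<^bsub>quotient_space V U\<^esub>"
    using x by (simp add: X add_quotient_space zero_quotient_space V.M.l_neg)
  moreover have "U +>\<^bsub>V\<^esub> (\<ominus>\<^bsub>V\<^esub> x) \<in> carrier (quotient_space V U)"
    using x by (simp add: carrier_quotient_space)
  ultimately show "\<exists>Y\<in>carrier (quotient_space V U).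
      Y \<oplus>\<^bsub>quotient_space V U\<^esub> X = \<zero>\<^bsub>quotient_space V U\<^esub>" by blast
\<comment> \<open>\<open>a_coset_add_zero\<close> would rewrite the zero coset back to
  \<open>U\<close>, where \<open>add_quotient_space\<close> no longer matches.\<close>
qed (auto simp: carrier_quotient_space add_quotient_space zero_quotient_space V.M.a_ac
    simp del: a_coset_add_zero)

lemma module_quotient_space: "module F (quotient_space V U)"
  by (rule moduleI)
    (auto simp: carrier_quotient_space add_quotient_space smult_quotient_space V.R.is_cring
      abelian_group_quotient_space V.smult_l_distr V.smult_r_distr V.smult_assoc1)

lemma linear_map_coset: "linear_map F V (quotient_space V U) (\<lambda>x. U +>\<^bsub>V\<^esub> x)"
  by (rule linear_mapI)
    (auto simp: carrier_quotient_space add_quotient_space smult_quotient_space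
      V.module_axioms module_quotient_space)

text \<open>Two members of a coset differ by an element of \<open>U\<close>, which \<open>g\<close>
  kills, so \<open>g\<close> is constant on the coset. The elements of \<open>W\<close> are sets
  here, and the union returns that constant value.\<close>

lemma lift_coset:
  assumes "linear_map F V W g" and vanish: "\<And>u. u \<in> U \<Longrightarrow> g u = \<zero>\<^bsub>W\<^esub>"
    and "x \<in> carrier V"
  shows "(\<Union>y\<in>U +>\<^bsub>V\<^esub> x. g y) = g x"
proof (rule UN_coset_const)
  interpret g: linear_map F V W g by fact
  fix y assume y: "y \<in> U +>\<^bsub>V\<^esub> x"
  then have yV: "y \<in> carrier V" and "y \<ominus>\<^bsub>V\<^esub> x \<in> U"
    using coset_subset assms(3) mem_coset_iff by blast+
  then have "g y \<ominus>\<^bsub>W\<^esub> g x = \<zero>\<^bsub>W\<^esub>"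
    using assms(3) vanish[of "y \<ominus>\<^bsub>V\<^esub> x"] g.map_minus[of y x] by simp
  then show "g y = g x"
    using yV assms(3) g.W.M.minus_eq_zero_iff[of "g y" "g x"] by simp
qed fact

text \<open>This is the universal property of the quotient, with the induced map in the form of a
  union so that it fits \<open>Inf2\<close> as defined.\<close>

lemma linear_map_lift:
  assumes "linear_map F V W g" "\<And>u. u \<in> U \<Longrightarrow> g u = \<zero>\<^bsub>W\<^esub>"
  shows "linear_map F (quotient_space V U) W (\<lambda>C. \<Union>y\<in>C. g y)"
proof -
  interpret g: linear_map F V W g by fact
  note lift = lift_coset[OF assms]
  show ?thesis
  proof (rule linear_mapI)
    fix X Y assume "X \<in> carrier (quotient_space V U)" "Y \<in> carrier (quotient_space V U)"
    then obtain x y where "x \<in> carrier V" "X = U +>\<^bsub>V\<^esub> x" "y \<in> carrier V" "Y = U +>\<^bsub>V\<^esub> y"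
      by (auto simp: carrier_quotient_space)
    then show "(\<Union>y\<in>X \<oplus>\<^bsub>quotient_space V U\<^esub> Y. g y) = (\<Union>y\<in>X. g y) \<oplus>\<^bsub>W\<^esub> (\<Union>y\<in>Y. g y)"
      by (simp only: add_quotient_space lift g.map_add V.M.a_closed)
  next
    fix a X assume "a \<in> carrier F" "X \<in> carrier (quotient_space V U)"
    then obtain x where "a \<in> carrier F" "x \<in> carrier V" "X = U +>\<^bsub>V\<^esub> x"
      by (auto simp: carrier_quotient_space)
    then show "(\<Union>y\<in>a \<odot>\<^bsub>quotient_space V U\<^esub> X. g y) = a \<odot>\<^bsub>W\<^esub> (\<Union>y\<in>X. g y)"
      by (simp only: smult_quotient_space lift g.map_smult V.smult_closed)
  qed (auto simp: carrier_quotient_space lift module_quotient_space g.modules)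
qed

end

section \<open>Bilinear maps and triassociative algebras\<close>

lemma bilinear_mapD:
  assumes "bilinear_map F V W f"
  shows "y \<in> carrier V \<Longrightarrow> linear_map F V W (\<lambda>x. f x y)"
    and "x \<in> carrier V \<Longrightarrow> linear_map F V W (\<lambda>y. f x y)"
  using assms by (auto simp: bilinear_map_def)

lemma bilinear_map_closed:
  "\<lbrakk>bilinear_map F V W f; x \<in> carrier V; y \<in> carrier V\<rbrakk> \<Longrightarrow> f x y \<in> carrier W"
  by (rule linear_map.closed[OF bilinear_mapD(1)])

lemma bilinear_map_cong:
  assumes "bilinear_map F V W f"
    and "\<And>x y. \<lbrakk>x \<in> carrier V; y \<in> carrier V\<rbrakk> \<Longrightarrow> g x y = f x y"
  shows "bilinear_map F V W g"
  unfolding bilinear_map_def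
proof (intro conjI ballI)
  fix x assume x: "x \<in> carrier V"
  show "linear_map F V W (\<lambda>y. g x y)"
    by (rule linear_map_cong[OF bilinear_mapD(2)[OF assms(1) x]]) (simp add: assms(2) x)
  show "linear_map F V W (\<lambda>y. g y x)"
    by (rule linear_map_cong[OF bilinear_mapD(1)[OF assms(1) x]]) (simp add: assms(2) x)
qed

lemma bilinear_map_zero:
  "module F V \<Longrightarrow> module F W \<Longrightarrow> bilinear_map F V W (\<lambda>_ _. \<zero>\<^bsub>W\<^esub>)"
  by (simp add: bilinear_map_def linear_map_zero)

lemma bilinear_map_add:
  "bilinear_map F V W f \<Longrightarrow> bilinear_map F V W g \<Longrightarrow> bilinear_map F V W (\<lambda>x y. f x y \<oplus>\<^bsub>W\<^esub> g x y)"
  by (simp add: bilinear_map_def linear_map_add)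

lemma bilinear_map_smult:
  "a \<in> carrier F \<Longrightarrow> bilinear_map F V W f \<Longrightarrow> bilinear_map F V W (\<lambda>x y. a \<odot>\<^bsub>W\<^esub> f x y)"
  by (simp add: bilinear_map_def linear_map_smult)

lemma bilinear_map_neg:
  "bilinear_map F V W f \<Longrightarrow> bilinear_map F V W (\<lambda>x y. \<ominus>\<^bsub>W\<^esub> f x y)"
  by (simp add: bilinear_map_def linear_map_neg)

lemma bilinear_map_comp_left:
  assumes "bilinear_map F V W f" "linear_map F W X h"
  shows "bilinear_map F V X (\<lambda>x y. h (f x y))"
  unfolding bilinear_map_def
  by (intro conjI ballI linear_map_comp[OF _ assms(2)] bilinear_mapD[OF assms(1)])

lemma bilinear_map_comp_right:
  assumes "bilinear_map F V W f" "linear_map F U V h"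
  shows "bilinear_map F U W (\<lambda>x y. f (h x) (h y))"
proof -
  interpret linear_map F U V h by fact
  show ?thesis
    unfolding bilinear_map_def
    by (intro conjI ballI linear_map_comp[OF assms(2), of W "\<lambda>y. f (h _) y"]
        linear_map_comp[OF assms(2), of W "\<lambda>x. f x (h _)"] bilinear_mapD[OF assms(1)] closed)
qed

text \<open>
  A quadruple \<open>(p, q, r, s)\<close> stands for the axiom \<open>(x q y) p z = x r (y s z)\<close>; the cocycle
  conditions are indexed by the same quadruples.
\<close>

definition triass_rules :: "(triop \<times> triop \<times> triop \<times> triop) set" where
  "triass_rules =
     {(Vdash, Vdash, Vdash, Vdash), (Dashv, Dashv, Dashv, Dashv), (Vdash, Dashv, Vdash, Vdash),
      (Dashv, Dashv, Dashv, Vdash), (Dashv, Vdash, Vdash, Dashv), (Vdash, Perp, Vdash, Vdash),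
      (Dashv, Dashv, Dashv, Perp), (Perp, Vdash, Vdash, Perp), (Dashv, Perp, Perp, Dashv),
      (Perp, Dashv, Perp, Vdash), (Perp, Perp, Perp, Perp)}"

lemma triassociative_algebra_iff:
  "triassociative_algebra F L \<longleftrightarrow> field F \<and> module F L \<and>
     (\<forall>p. bilinear_map F L L (triprod L p)) \<and>
     (\<forall>(p, q, r, s)\<in>triass_rules. \<forall>x\<in>carrier L. \<forall>y\<in>carrier L. \<forall>z\<in>carrier L.
        triprod L p (triprod L q x y) z = triprod L r x (triprod L s y z))"
  unfolding triassociative_algebra_def triassociative_algebra_axioms_def triass_rules_def
  \<comment> \<open>The locale states its axioms with implications, the right side with bounded
    quantifiers; \<open>Ball_def\<close> brings both to one form.\<close>
  by (simp add: ball_conj_distrib) (simp only: Ball_def)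

text \<open>Each axiom \<open>(x q y) p z = x r (y s z)\<close> yields the cocycle condition with
  \<open>f p\<close> and \<open>f r\<close> as the outer operations. One argument for a generic
  quadruple thus settles all eleven identities at once.\<close>

lemma cocycles_iff:
  "f \<in> cocycles F B A \<longleftrightarrow>
     (\<forall>p. f p \<in> carrier B \<rightarrow>\<^sub>E carrier B \<rightarrow>\<^sub>E carrier A) \<and>
     (\<forall>p. bilinear_map F B A (f p)) \<and>
     (\<forall>(p, q, r, s)\<in>triass_rules. \<forall>x\<in>carrier B. \<forall>y\<in>carrier B. \<forall>z\<in>carrier B.
        f p (triprod B q x y) z = f r x (triprod B s y z))"
  unfolding cocycles_def triass_rules_def
  by (simp add: ball_conj_distrib)

context triassociative_algebra
begin

lemma prod_closed [simp, intro]: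
  "\<lbrakk>x \<in> carrier L; y \<in> carrier L\<rbrakk> \<Longrightarrow> triprod L p x y \<in> carrier L"
  using bilinear_map_closed[OF bilinear] .

lemma assoc:
  "\<lbrakk>(p, q, r, s) \<in> triass_rules; x \<in> carrier L; y \<in> carrier L; z \<in> carrier L\<rbrakk> \<Longrightarrow>
    triprod L p (triprod L q x y) z = triprod L r x (triprod L s y z)"
  using triassociative_algebra_axioms by (auto simp: triassociative_algebra_iff)

lemma prod_minus_left:
  "\<lbrakk>x \<in> carrier L; y \<in> carrier L; z \<in> carrier L\<rbrakk> \<Longrightarrow>
    triprod L p (x \<ominus> y) z = triprod L p x z \<ominus> triprod L p y z"
  using linear_map.map_minus[OF bilinear_mapD(1)[OF bilinear]] .

lemma prod_minus_right:
  "\<lbrakk>x \<in> carrier L; y \<in> carrier L; z \<in> carrier L\<rbrakk> \<Longrightarrow>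
    triprod L p z (x \<ominus> y) = triprod L p z x \<ominus> triprod L p z y"
  using linear_map.map_minus[OF bilinear_mapD(2)[OF bilinear]] .

end

section \<open>The quotient of a triassociative algebra by an ideal\<close>

lemma triass_quotient_simps:
  "carrier (triass_quotient L I) = carrier (quotient_space L I)"
  "zero (triass_quotient L I) = zero (quotient_space L I)"
  "add (triass_quotient L I) = add (quotient_space L I)"
  "smult (triass_quotient L I) = smult (quotient_space L I)"
  "triprod (triass_quotient L I) p X Y = (\<Union>x\<in>X. \<Union>y\<in>Y. I +>\<^bsub>L\<^esub> triprod L p x y)"
  by (simp_all add: triass_quotient_def module.extend_def triass.fields_def)

locale ideal_quotient = triassociative_algebra F L for F and L :: "('f, 'l) triass" (structure) +
  fixes I assumes ideal: "triass_ideal F L I"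
begin

sublocale quotient_module F L I
  using ideal
  by (intro quotient_module.intro quotient_module_axioms.intro L.module_axioms)
    (simp add: triass_ideal_def)

abbreviation "Q \<equiv> triass_quotient L I"

lemma carrier_Q: "carrier Q = (\<lambda>x. I +> x) ` carrier L"
  by (simp add: triass_quotient_simps carrier_quotient_space)

lemma add_Q: "\<lbrakk>x \<in> carrier L; y \<in> carrier L\<rbrakk> \<Longrightarrow> (I +> x) \<oplus>\<^bsub>Q\<^esub> (I +> y) = I +> (x \<oplus> y)"
  by (simp add: triass_quotient_simps add_quotient_space)

lemma smult_Q: "\<lbrakk>a \<in> carrier F; x \<in> carrier L\<rbrakk> \<Longrightarrow> a \<odot>\<^bsub>Q\<^esub> (I +> x) = I +> (a \<odot> x)"
  by (simp add: triass_quotient_simps smult_quotient_space)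

lemma module_Q: "module F Q"
  by (rule module_cong[OF module_quotient_space]) (simp_all add: triass_quotient_simps)

lemma linear_map_coset_Q: "linear_map F L Q (\<lambda>x. I +> x)"
  by (rule linear_map_cong_spaces[OF linear_map_coset]) (simp_all add: triass_quotient_simps)

text \<open>The product is independent of representatives: passing from \<open>x' * y'\<close> to
  \<open>x * y'\<close> and then to \<open>x * y\<close> changes it by \<open>(x' - x) * y'\<close>
  and \<open>x * (y' - y)\<close>, both of which lie in the ideal.\<close>

lemma prod_coset:
  assumes "x \<in> carrier L" "y \<in> carrier L"
  shows "triprod Q p (I +> x) (I +> y) = I +> triprod L p x y"
proof -
  have "I +> triprod L p x' y' = I +> triprod L p x y"
    if "x' \<in> I +> x" "y' \<in> I +> y" for x' y'
  proof -
    have carr: "x' \<in> carrier L" "y' \<in> carrier L"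
      using that assms coset_subset by blast+
    then have "x' \<ominus> x \<in> I" "y' \<ominus> y \<in> I"
      using that assms mem_coset_iff by blast+
    then have "triprod L p (x' \<ominus> x) y' \<in> I" "triprod L p x (y' \<ominus> y) \<in> I"
      using ideal assms carr by (auto simp: triass_ideal_def)
    then have "triprod L p x' y' \<ominus> triprod L p x y' \<in> I"
      "triprod L p x y' \<ominus> triprod L p x y \<in> I"
      using assms carr by (simp_all add: prod_minus_left prod_minus_right)
    then show ?thesis
      using assms carr by (simp flip: coset_eq_iff)
  qed
  \<comment> \<open>A union of constant sets equals the constant only over nonempty index
    sets.\<close>
  moreover have "I +> x \<noteq> {}" "I +> y \<noteq> {}"
    using U.a_rcos_self assms by blast+
  ultimately show ?thesis
    unfolding triass_quotient_simps by (intro SUP_eq_const)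
qed

lemma bilinear_Q: "bilinear_map F Q Q (triprod Q p)"
proof -
  have "linear_map F Q Q (triprod Q p X)" "linear_map F Q Q (\<lambda>X'. triprod Q p X' X)"
    if X: "X \<in> carrier Q" for X
  proof -
    obtain x where x: "x \<in> carrier L" "X = I +> x"
      using X by (auto simp: carrier_Q)
    interpret l: linear_map F L L "triprod L p x"
      using bilinear_mapD(2)[OF bilinear x(1)] .
    interpret r: linear_map F L L "\<lambda>y. triprod L p y x"
      using bilinear_mapD(1)[OF bilinear x(1)] .
    note [simp] = prod_coset x
    show "linear_map F Q Q (triprod Q p X)"
      by (rule linear_mapI)
        (auto simp: carrier_Q add_Q smult_Q module_Q l.map_add l.map_smult)
    show "linear_map F Q Q (\<lambda>X'. triprod Q p X' X)"
      by (rule linear_mapI)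
        (auto simp: carrier_Q add_Q smult_Q module_Q r.map_add r.map_smult)
  qed
  then show ?thesis
    by (simp add: bilinear_map_def)
qed

text \<open>Every element of \<open>Q\<close> is a coset and the coset map preserves products, so
  each axiom of \<open>L\<close> descends.\<close>

sublocale Q: triassociative_algebra F Q
  unfolding triassociative_algebra_iff
proof (intro conjI allI ballI field_axioms module_Q bilinear_Q, clarify)
  fix p q r s X Y Z
  assume rule: "(p, q, r, s) \<in> triass_rules"
    and "X \<in> carrier Q" "Y \<in> carrier Q" "Z \<in> carrier Q"
  then obtain x y z where "x \<in> carrier L" "X = I +> x" "y \<in> carrier L" "Y = I +> y"
    "z \<in> carrier L" "Z = I +> z"
    by (auto simp: carrier_Q)
  then show "triprod Q p (triprod Q q X Y) Z = triprod Q r X (triprod Q s Y Z)"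
    by (simp add: prod_coset assoc[OF rule])
qed

end

section \<open>Homomorphism spaces and second cohomology\<close>

lemma linear_map_trivial_triass_iff:
  "linear_map F B (trivial_triass A) h \<longleftrightarrow> linear_map F B A h"
  by (auto simp: trivial_triass_def module.extend_def elim!: linear_map_cong_spaces)

text \<open>The products of the target vanish, so being multiplicative means killing every
  product.\<close>

lemma Hom_space_carrier_iff:
  "h \<in> carrier (Hom_space F B A) \<longleftrightarrow>
     h \<in> extensional (carrier B) \<and> linear_map F B A h \<and>
     (\<forall>p. \<forall>x\<in>carrier B. \<forall>y\<in>carrier B. h (triprod B p x y) = \<zero>\<^bsub>A\<^esub>)"
  by (simp add: Hom_space_def triass_hom_def linear_map_trivial_triass_iff)
    (simp add: trivial_triass_def module.extend_def triass.fields_def)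

lemma Hom_space_simps:
  "\<zero>\<^bsub>Hom_space F B A\<^esub> = (\<lambda>x\<in>carrier B. \<zero>\<^bsub>A\<^esub>)"
  "g \<oplus>\<^bsub>Hom_space F B A\<^esub> h = (\<lambda>x\<in>carrier B. g x \<oplus>\<^bsub>A\<^esub> h x)"
  "a \<odot>\<^bsub>Hom_space F B A\<^esub> h = (\<lambda>x\<in>carrier B. a \<odot>\<^bsub>A\<^esub> h x)"
  by (simp_all add: Hom_space_def)

lemma Hom_space_apply:
  assumes "x \<in> carrier B"
  shows "\<zero>\<^bsub>Hom_space F B A\<^esub> x = \<zero>\<^bsub>A\<^esub>"
    and "(g \<oplus>\<^bsub>Hom_space F B A\<^esub> h) x = g x \<oplus>\<^bsub>A\<^esub> h x"
    and "(a \<odot>\<^bsub>Hom_space F B A\<^esub> h) x = a \<odot>\<^bsub>A\<^esub> h x"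
  using assms by (simp_all add: Hom_space_simps)

text \<open>Products must stay in the carrier because \<open>restrict\<close> makes the map
  \<open>undefined\<close> elsewhere.\<close>

lemma restrict_mem_Hom_spaceI:
  assumes "linear_map F B A h"
    and "\<And>p x y. \<lbrakk>x \<in> carrier B; y \<in> carrier B\<rbrakk> \<Longrightarrow> triprod B p x y \<in> carrier B"
    and "\<And>p x y. \<lbrakk>x \<in> carrier B; y \<in> carrier B\<rbrakk> \<Longrightarrow> h (triprod B p x y) = \<zero>\<^bsub>A\<^esub>"
  shows "restrict h (carrier B) \<in> carrier (Hom_space F B A)"
  using assms by (auto simp: Hom_space_carrier_iff intro: linear_map_cong[OF assms(1)])

lemma Hom_space_eqI:
  assumes "g \<in> carrier (Hom_space F B A)" "h \<in> carrier (Hom_space F B A)"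
    and "\<And>x. x \<in> carrier B \<Longrightarrow> g x = h x"
  shows "g = h"
  using assms by (intro extensionalityI[of g "carrier B"]) (auto simp: Hom_space_carrier_iff)

lemma Hom_spaceD:
  assumes "h \<in> carrier (Hom_space F B A)"
  shows "linear_map F B A h"
    and "\<lbrakk>x \<in> carrier B; y \<in> carrier B\<rbrakk> \<Longrightarrow> h (triprod B p x y) = \<zero>\<^bsub>A\<^esub>"
  using assms by (simp_all add: Hom_space_carrier_iff)

lemma Hom_space_closed:
  "\<lbrakk>h \<in> carrier (Hom_space F B A); x \<in> carrier B\<rbrakk> \<Longrightarrow> h x \<in> carrier A"
  by (rule linear_map.closed[OF Hom_spaceD(1)])

text \<open>The operations are pointwise and the maps extensional, so each module law reduces to the
  same law in \<open>A\<close>. Stating the requirements on \<open>B\<close> as a module with closed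
  products lets the lemma serve \<open>Q\<close>, \<open>L\<close> and the ideal alike.\<close>

lemma module_Hom_space:
  assumes "module F B" "module F A"
    and prod: "\<And>p x y. \<lbrakk>x \<in> carrier B; y \<in> carrier B\<rbrakk> \<Longrightarrow> triprod B p x y \<in> carrier B"
  shows "module F (Hom_space F B A)"
proof -
  interpret A: module F A by fact
  have zero: "\<zero>\<^bsub>Hom_space F B A\<^esub> \<in> carrier (Hom_space F B A)"
    unfolding Hom_space_simps
    by (rule restrict_mem_Hom_spaceI) (simp_all add: linear_map_zero assms)
  have add: "g \<oplus>\<^bsub>Hom_space F B A\<^esub> h \<in> carrier (Hom_space F B A)"
    if "g \<in> carrier (Hom_space F B A)" "h \<in> carrier (Hom_space F B A)" for g h
    unfolding Hom_space_simps using that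
    by (intro restrict_mem_Hom_spaceI linear_map_add) (auto simp: Hom_space_carrier_iff prod)
  have smult: "a \<odot>\<^bsub>Hom_space F B A\<^esub> h \<in> carrier (Hom_space F B A)"
    if "a \<in> carrier F" "h \<in> carrier (Hom_space F B A)" for a h
    unfolding Hom_space_simps using that
    by (intro restrict_mem_Hom_spaceI linear_map_smult) (auto simp: Hom_space_carrier_iff prod)
  have neg: "(\<lambda>x\<in>carrier B. \<ominus>\<^bsub>A\<^esub> h x) \<in> carrier (Hom_space F B A)"
    if "h \<in> carrier (Hom_space F B A)" for h
    using that
    by (intro restrict_mem_Hom_spaceI linear_map_neg) (auto simp: Hom_space_carrier_iff prod)
  note [simp] = zero add smult Hom_space_apply Hom_space_closed
  note eqI = Hom_space_eqI[of _ F B A]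
  show ?thesis
  proof (rule moduleI)
    show "abelian_group (Hom_space F B A)"
    proof (rule abelian_groupI)
      fix h assume h: "h \<in> carrier (Hom_space F B A)"
      show "\<exists>g\<in>carrier (Hom_space F B A). g \<oplus>\<^bsub>Hom_space F B A\<^esub> h = \<zero>\<^bsub>Hom_space F B A\<^esub>"
        by (rule bexI[OF _ neg[OF h]]) (use h neg[OF h] in \<open>auto intro!: eqI simp: A.M.l_neg\<close>)
    qed (auto intro!: eqI simp: A.M.a_ac)
  qed (auto intro!: eqI
      simp: A.R.is_cring A.smult_l_distr A.smult_r_distr A.smult_assoc1)
qed

section \<open>Cocycles, coboundaries and the second cohomology space\<close>

definition coboundary ::
  "('f, 'b) triass \<Rightarrow> ('f, 'a) module \<Rightarrow> ('b \<Rightarrow> 'a) \<Rightarrow> triop \<Rightarrow> 'b \<Rightarrow> 'b \<Rightarrow> 'a" where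
  "coboundary B A \<epsilon> = (\<lambda>p. \<lambda>x\<in>carrier B. \<lambda>y\<in>carrier B. \<ominus>\<^bsub>A\<^esub> \<epsilon> (triprod B p x y))"

lemma B2_eq: "B2 F B A = {coboundary B A \<epsilon> | \<epsilon>. linear_map F B A \<epsilon>}"
  by (simp add: B2_def coboundary_def)

lemma Z2_simps:
  "carrier (Z2 F B A) = cocycles F B A"
  "\<zero>\<^bsub>Z2 F B A\<^esub> = (\<lambda>p. \<lambda>x\<in>carrier B. \<lambda>y\<in>carrier B. \<zero>\<^bsub>A\<^esub>)"
  "f \<oplus>\<^bsub>Z2 F B A\<^esub> g = (\<lambda>p. \<lambda>x\<in>carrier B. \<lambda>y\<in>carrier B. f p x y \<oplus>\<^bsub>A\<^esub> g p x y)"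
  "a \<odot>\<^bsub>Z2 F B A\<^esub> f = (\<lambda>p. \<lambda>x\<in>carrier B. \<lambda>y\<in>carrier B. a \<odot>\<^bsub>A\<^esub> f p x y)"
  by (simp_all add: Z2_def)

lemma Z2_apply:
  assumes "x \<in> carrier B" "y \<in> carrier B"
  shows "\<zero>\<^bsub>Z2 F B A\<^esub> p x y = \<zero>\<^bsub>A\<^esub>"
    and "(f \<oplus>\<^bsub>Z2 F B A\<^esub> g) p x y = f p x y \<oplus>\<^bsub>A\<^esub> g p x y"
    and "(a \<odot>\<^bsub>Z2 F B A\<^esub> f) p x y = a \<odot>\<^bsub>A\<^esub> f p x y"
  using assms by (simp_all add: Z2_simps)

lemma restrict_mem_cocyclesI:
  assumes "\<And>p. bilinear_map F B A (f p)"
    and "\<And>p x y. \<lbrakk>x \<in> carrier B; y \<in> carrier B\<rbrakk> \<Longrightarrow> triprod B p x y \<in> carrier B"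
    and "\<And>p q r s x y z.
      \<lbrakk>(p, q, r, s) \<in> triass_rules; x \<in> carrier B; y \<in> carrier B; z \<in> carrier B\<rbrakk> \<Longrightarrow>
        f p (triprod B q x y) z = f r x (triprod B s y z)"
  shows "(\<lambda>p. \<lambda>x\<in>carrier B. \<lambda>y\<in>carrier B. f p x y) \<in> cocycles F B A"
  unfolding cocycles_iff
proof (intro conjI allI)
  fix p
  show "(\<lambda>x\<in>carrier B. \<lambda>y\<in>carrier B. f p x y) \<in> carrier B \<rightarrow>\<^sub>E carrier B \<rightarrow>\<^sub>E carrier A"
    using bilinear_map_closed[OF assms(1)] by auto
  show "bilinear_map F B A (\<lambda>x\<in>carrier B. \<lambda>y\<in>carrier B. f p x y)"
    by (rule bilinear_map_cong[OF assms(1)]) auto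
qed (use assms(2,3) in auto)

lemma cocyclesD:
  assumes "f \<in> cocycles F B A"
  shows "bilinear_map F B A (f p)"
    and "\<lbrakk>(p, q, r, s) \<in> triass_rules; x \<in> carrier B; y \<in> carrier B; z \<in> carrier B\<rbrakk> \<Longrightarrow>
      f p (triprod B q x y) z = f r x (triprod B s y z)"
  using assms unfolding cocycles_iff by blast+

lemma cocycles_closed:
  "\<lbrakk>f \<in> cocycles F B A; x \<in> carrier B; y \<in> carrier B\<rbrakk> \<Longrightarrow> f p x y \<in> carrier A"
  by (rule bilinear_map_closed[OF cocyclesD(1)])

lemma cocycles_eqI:
  assumes "f \<in> cocycles F B A" "g \<in> cocycles F B A"
    and "\<And>p x y. \<lbrakk>x \<in> carrier B; y \<in> carrier B\<rbrakk> \<Longrightarrow> f p x y = g p x y"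
  shows "f = g"
proof
  fix p
  have fg: "f p \<in> carrier B \<rightarrow>\<^sub>E carrier B \<rightarrow>\<^sub>E carrier A" "g p \<in> carrier B \<rightarrow>\<^sub>E carrier B \<rightarrow>\<^sub>E carrier A"
    using assms(1,2) by (simp_all add: cocycles_iff)
  show "f p = g p"
  proof (rule PiE_ext[OF fg])
    fix x assume x: "x \<in> carrier B"
    show "f p x = g p x"
      \<comment> \<open>Cochains are extensional in each argument separately, hence a second use of
        \<open>PiE_ext\<close> for the inner function.\<close>
      by (rule PiE_ext[OF fg[THEN PiE_mem, OF x]]) (rule assms(3)[OF x])
  qed
qed

locale cohomology = B?: triassociative_algebra F B + A?: module F A
  for F and B :: "('f, 'b) triass" and A :: "('f, 'a) module"
begin

lemma zero_cocycle: "\<zero>\<^bsub>Z2 F B A\<^esub> \<in> cocycles F B A"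
  unfolding Z2_simps
  by (rule restrict_mem_cocyclesI) (simp_all add: bilinear_map_zero B.L.module_axioms A.module_axioms)

lemma add_cocycle:
  "\<lbrakk>f \<in> cocycles F B A; g \<in> cocycles F B A\<rbrakk> \<Longrightarrow> f \<oplus>\<^bsub>Z2 F B A\<^esub> g \<in> cocycles F B A"
  unfolding Z2_simps
  by (rule restrict_mem_cocyclesI) (auto intro: bilinear_map_add cocyclesD(1) simp: cocyclesD(2))

lemma smult_cocycle:
  "\<lbrakk>a \<in> carrier F; f \<in> cocycles F B A\<rbrakk> \<Longrightarrow> a \<odot>\<^bsub>Z2 F B A\<^esub> f \<in> cocycles F B A"
  unfolding Z2_simps
  by (rule restrict_mem_cocyclesI) (auto intro: bilinear_map_smult cocyclesD(1) simp: cocyclesD(2))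

lemma neg_cocycle:
  "f \<in> cocycles F B A \<Longrightarrow>
    (\<lambda>p. \<lambda>x\<in>carrier B. \<lambda>y\<in>carrier B. \<ominus>\<^bsub>A\<^esub> f p x y) \<in> cocycles F B A"
  by (rule restrict_mem_cocyclesI) (auto intro: bilinear_map_neg cocyclesD(1) simp: cocyclesD(2))

lemma module_Z2: "module F (Z2 F B A)"
proof (rule moduleI)
  note [simp] = zero_cocycle add_cocycle smult_cocycle Z2_apply cocycles_closed Z2_simps(1)
  note eqI = cocycles_eqI[of _ F B A]
  show "abelian_group (Z2 F B A)"
  proof (rule abelian_groupI)
    fix f assume "f \<in> carrier (Z2 F B A)"
    then have f: "f \<in> cocycles F B A"
      by simp
    show "\<exists>g\<in>carrier (Z2 F B A). g \<oplus>\<^bsub>Z2 F B A\<^esub> f = \<zero>\<^bsub>Z2 F B A\<^esub>"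
      using f neg_cocycle[OF f]
      by (intro bexI[of _ "\<lambda>p. \<lambda>x\<in>carrier B. \<lambda>y\<in>carrier B. \<ominus>\<^bsub>A\<^esub> f p x y"])
        (auto intro!: eqI simp: A.M.l_neg)
  qed (auto intro!: eqI simp: A.M.a_ac)
  show "cring F"
    by (rule B.is_cring)
qed (auto intro!: cocycles_eqI[of _ F B A] simp: zero_cocycle add_cocycle smult_cocycle Z2_apply
    cocycles_closed Z2_simps(1) A.smult_l_distr A.smult_r_distr A.smult_assoc1)

sublocale Z2: module F "Z2 F B A"
  by (rule module_Z2)

lemma Z2_neg:
  assumes "f \<in> cocycles F B A"
  shows "\<ominus>\<^bsub>Z2 F B A\<^esub> f = (\<lambda>p. \<lambda>x\<in>carrier B. \<lambda>y\<in>carrier B. \<ominus>\<^bsub>A\<^esub> f p x y)"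
proof (rule Z2.M.minus_equality)
  show "(\<lambda>p. \<lambda>x\<in>carrier B. \<lambda>y\<in>carrier B. \<ominus>\<^bsub>A\<^esub> f p x y) \<oplus>\<^bsub>Z2 F B A\<^esub> f = \<zero>\<^bsub>Z2 F B A\<^esub>"
    using assms neg_cocycle[OF assms]
    by (intro cocycles_eqI[of _ F B A])
      (auto simp: zero_cocycle add_cocycle Z2_apply A.M.l_neg cocycles_closed)
qed (use assms neg_cocycle in \<open>simp_all add: Z2_simps(1)\<close>)

lemma Z2_minus_apply:
  assumes "f \<in> cocycles F B A" "g \<in> cocycles F B A" "x \<in> carrier B" "y \<in> carrier B"
  shows "(f \<ominus>\<^bsub>Z2 F B A\<^esub> g) p x y = f p x y \<ominus>\<^bsub>A\<^esub> g p x y"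
  using assms by (simp add: a_minus_def Z2_neg Z2_simps(3))

text \<open>Applying \<epsilon> to both sides of an axiom of \<open>B\<close> gives exactly the
  corresponding cocycle identity.\<close>

lemma coboundary_cocycle:
  assumes "linear_map F B A \<epsilon>"
  shows "coboundary B A \<epsilon> \<in> cocycles F B A"
  unfolding coboundary_def
  by (rule restrict_mem_cocyclesI)
    (auto intro!: bilinear_map_neg bilinear_map_comp_left[OF _ assms] B.bilinear
      simp: B.assoc)

lemma coboundary_apply:
  "\<lbrakk>x \<in> carrier B; y \<in> carrier B\<rbrakk> \<Longrightarrow> coboundary B A \<epsilon> p x y = \<ominus>\<^bsub>A\<^esub> \<epsilon> (triprod B p x y)"
  by (simp add: coboundary_def)

lemma coboundary_eqI:
  assumes "f \<in> cocycles F B A" "linear_map F B A \<epsilon>"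
    and "\<And>p x y. \<lbrakk>x \<in> carrier B; y \<in> carrier B\<rbrakk> \<Longrightarrow> f p x y = \<ominus>\<^bsub>A\<^esub> \<epsilon> (triprod B p x y)"
  shows "f = coboundary B A \<epsilon>"
  by (rule cocycles_eqI[OF assms(1) coboundary_cocycle[OF assms(2)]])
    (simp add: assms(3) coboundary_apply)

text \<open>Equality with a coboundary becomes a family of pointwise equations; cocycles are
  extensional, so nothing is lost.\<close>

lemma B2_iff:
  "f \<in> B2 F B A \<longleftrightarrow> f \<in> cocycles F B A \<and>
    (\<exists>\<epsilon>. linear_map F B A \<epsilon> \<and>
      (\<forall>p. \<forall>x\<in>carrier B. \<forall>y\<in>carrier B. f p x y = \<ominus>\<^bsub>A\<^esub> \<epsilon> (triprod B p x y)))"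
  unfolding B2_eq using coboundary_eqI by (auto simp: coboundary_cocycle coboundary_apply) blast

lemma B2I:
  assumes "f \<in> cocycles F B A" "linear_map F B A \<epsilon>"
    and "\<And>p x y. \<lbrakk>x \<in> carrier B; y \<in> carrier B\<rbrakk> \<Longrightarrow> f p x y = \<ominus>\<^bsub>A\<^esub> \<epsilon> (triprod B p x y)"
  shows "f \<in> B2 F B A"
  using assms B2_iff by blast

text \<open>The coboundary depends linearly on \<epsilon>, so the witnesses are the zero map,
  \<epsilon> + \<delta>, -\<epsilon> and the scalar multiple of \<epsilon>.\<close>

lemma submodule_B2: "submodule (B2 F B A) F (Z2 F B A)"
proof (rule Z2.submoduleI)
  show "B2 F B A \<subseteq> carrier (Z2 F B A)"
    by (auto simp: B2_iff Z2_simps(1))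
  show "\<zero>\<^bsub>Z2 F B A\<^esub> \<in> B2 F B A"
    by (rule B2I[OF zero_cocycle linear_map_zero[OF B.L.module_axioms A.module_axioms]])
      (simp add: Z2_apply A.M.neg_zero)
next
  fix f g assume "f \<in> B2 F B A" "g \<in> B2 F B A"
  then obtain \<epsilon> \<delta> where f: "f \<in> cocycles F B A" "linear_map F B A \<epsilon>"
      "\<And>p x y. \<lbrakk>x \<in> carrier B; y \<in> carrier B\<rbrakk> \<Longrightarrow> f p x y = \<ominus>\<^bsub>A\<^esub> \<epsilon> (triprod B p x y)"
    and g: "g \<in> cocycles F B A" "linear_map F B A \<delta>"
      "\<And>p x y. \<lbrakk>x \<in> carrier B; y \<in> carrier B\<rbrakk> \<Longrightarrow> g p x y = \<ominus>\<^bsub>A\<^esub> \<delta> (triprod B p x y)"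
    unfolding B2_iff by blast
  interpret \<epsilon>: linear_map F B A \<epsilon> by (rule f(2))
  interpret \<delta>: linear_map F B A \<delta> by (rule g(2))
  show "f \<oplus>\<^bsub>Z2 F B A\<^esub> g \<in> B2 F B A"
    by (rule B2I[OF add_cocycle[OF f(1) g(1)] linear_map_add[OF f(2) g(2)]])
      (simp add: Z2_apply f g A.M.minus_add)
next
  fix f assume "f \<in> B2 F B A"
  then obtain \<epsilon> where f: "f \<in> cocycles F B A" "linear_map F B A \<epsilon>"
      "\<And>p x y. \<lbrakk>x \<in> carrier B; y \<in> carrier B\<rbrakk> \<Longrightarrow> f p x y = \<ominus>\<^bsub>A\<^esub> \<epsilon> (triprod B p x y)"
    unfolding B2_iff by blast
  interpret \<epsilon>: linear_map F B A \<epsilon> by (rule f(2))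
  show "\<ominus>\<^bsub>Z2 F B A\<^esub> f \<in> B2 F B A"
    by (rule B2I[OF _ linear_map_neg[OF f(2)]])
      (simp_all add: Z2_neg neg_cocycle f)
  fix a assume a: "a \<in> carrier F"
  show "a \<odot>\<^bsub>Z2 F B A\<^esub> f \<in> B2 F B A"
    by (rule B2I[OF smult_cocycle[OF a f(1)] linear_map_smult[OF a f(2)]])
      (simp add: Z2_apply f a A.smult_r_minus)
qed

sublocale H2: quotient_module F "Z2 F B A" "B2 F B A"
  by (intro quotient_module.intro quotient_module_axioms.intro module_Z2 submodule_B2)

lemma linear_map_cohomology_class:
  "linear_map F (Z2 F B A) (H2 F B A) (cohomology_class F B A)"
  unfolding H2_def cohomology_class_def by (rule H2.linear_map_coset)

lemma carrier_H2: "carrier (H2 F B A) = cohomology_class F B A ` cocycles F B A"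
  unfolding H2_def cohomology_class_def by (simp add: H2.carrier_quotient_space Z2_simps(1))

text \<open>Classes agree when the difference is a coboundary. In this form a claim about classes
  asks only for a linear \<epsilon>, which the exactness proofs supply.\<close>

lemma cohomology_class_eq_iff:
  assumes "f \<in> cocycles F B A" "g \<in> cocycles F B A"
  shows "cohomology_class F B A f = cohomology_class F B A g \<longleftrightarrow>
    (\<exists>\<epsilon>. linear_map F B A \<epsilon> \<and>
      (\<forall>p. \<forall>x\<in>carrier B. \<forall>y\<in>carrier B. f p x y \<ominus>\<^bsub>A\<^esub> g p x y = \<ominus>\<^bsub>A\<^esub> \<epsilon> (triprod B p x y)))"
proof -
  have "f \<ominus>\<^bsub>Z2 F B A\<^esub> g \<in> cocycles F B A"
    using Z2.M.minus_closed[of f g] assms by (simp add: Z2_simps(1))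
  then show ?thesis
    unfolding cohomology_class_def using assms
    by (simp add: H2.coset_eq_iff Z2_simps(1) B2_iff Z2_minus_apply)
qed

lemma cohomology_class_eq_zero_iff:
  assumes "f \<in> cocycles F B A"
  shows "cohomology_class F B A f = \<zero>\<^bsub>H2 F B A\<^esub> \<longleftrightarrow>
    (\<exists>\<epsilon>. linear_map F B A \<epsilon> \<and>
      (\<forall>p. \<forall>x\<in>carrier B. \<forall>y\<in>carrier B. f p x y = \<ominus>\<^bsub>A\<^esub> \<epsilon> (triprod B p x y)))"
proof -
  have "\<zero>\<^bsub>H2 F B A\<^esub> = cohomology_class F B A \<zero>\<^bsub>Z2 F B A\<^esub>"
    unfolding H2_def cohomology_class_def by (rule H2.zero_quotient_space)
  then show ?thesis
    using assms
    by (simp add: cohomology_class_eq_iff zero_cocycle Z2_apply a_minus_def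
        A.M.neg_zero cocycles_closed)
qed

end

section \<open>Central extensions\<close>

locale central_extension = triassociative_algebra F L + A?: module F A
  for F and L :: "('f, 'l) triass" (structure) and A :: "('f, 'a) module" +
  fixes Z \<mu>
  assumes central: "central_ideal F L Z"
    and "section": "is_section F L Z \<mu>"
begin

sublocale ideal_quotient F L Z
  using central by unfold_locales (simp add: central_ideal_def)

sublocale CQ: cohomology F Q A ..

sublocale CL: cohomology F L A ..

text \<open>The ideal as an algebra in its own right: it keeps the operations of \<open>L\<close>,
  and centrality makes its products zero.\<close>

abbreviation LZ :: "('f, 'l) triass" where "LZ \<equiv> L\<lparr>carrier := Z\<rparr>"

abbreviation HQ :: "('f, 'l set \<Rightarrow> 'a) module" where "HQ \<equiv> Hom_space F Q A"
abbreviation HL :: "('f, 'l \<Rightarrow> 'a) module" where "HL \<equiv> Hom_space F L A"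
abbreviation HZ :: "('f, 'l \<Rightarrow> 'a) module" where "HZ \<equiv> Hom_space F LZ A"

sublocale sec: linear_map F Q L \<mu>
  using "section" by (simp add: is_section_def)

lemma Z_subset: "x \<in> Z \<Longrightarrow> x \<in> carrier L"
  using U.a_subset by blast

lemma coset_mem_Q [simp, intro]: "x \<in> carrier L \<Longrightarrow> Z +> x \<in> carrier Q"
  by (simp add: carrier_Q)

lemma coset_section: "X \<in> carrier Q \<Longrightarrow> Z +> \<mu> X = X"
  using "section" by (simp add: is_section_def natural_map_def)

lemma central_prod:
  assumes "z \<in> Z" "x \<in> carrier L"
  shows "triprod L p z x = \<zero>" "triprod L p x z = \<zero>"
  using central assms by (auto simp: central_ideal_def triass_center_def)

section \<open>The retraction onto the central ideal and the section cocycle\<close>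

definition retraction :: "'l \<Rightarrow> 'l" where
  "retraction x = x \<ominus> \<mu> (Z +> x)"

text \<open>As \<mu> is a section, \<open>x\<close> and \<open>\<mu> (Z +> x)\<close> lie in the
  same coset.\<close>

lemma retraction_mem: "x \<in> carrier L \<Longrightarrow> retraction x \<in> Z"
  using coset_eq_iff[of x "\<mu> (Z +> x)"] coset_section[of "Z +> x"]
  by (simp add: retraction_def)

lemma linear_map_retraction: "linear_map F L LZ retraction"
proof (rule linear_map_subspace_codomain[OF _ submodule])
  show "linear_map F L L retraction"
    unfolding retraction_def
    by (intro linear_map_minus linear_map_id L.module_axioms
        linear_map_comp[OF linear_map_coset_Q sec.linear_map_axioms])
qed (rule retraction_mem)

text \<open>The coset of \<open>z\<close> is the zero of \<open>Q\<close>, and the linear map \<mu>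
  sends it to zero.\<close>

lemma retraction_central: "z \<in> Z \<Longrightarrow> retraction z = z"
proof -
  assume z: "z \<in> Z"
  then have "Z +> z = \<zero>\<^bsub>Q\<^esub>"
    by (simp add: U.a_rcos_const triass_quotient_simps quotient_space_def)
  then show ?thesis
    using z by (simp add: retraction_def a_minus_def sec.map_zero L.M.neg_zero Z_subset)
qed

text \<open>Each factor differs from its lift by an element of \<open>Z\<close>, and such elements
  annihilate everything; the factors are exchanged one at a time.\<close>

lemma prod_section:
  assumes "x \<in> carrier L" "y \<in> carrier L"
  shows "triprod L p (\<mu> (Z +> x)) (\<mu> (Z +> y)) = triprod L p x y"
proof -
  let ?x = "\<mu> (Z +> x)" and ?y = "\<mu> (Z +> y)"
  have "x \<ominus> ?x \<in> Z" "y \<ominus> ?y \<in> Z"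
    using retraction_mem assms by (simp_all flip: retraction_def)
  then have "triprod L p (x \<ominus> ?x) y = \<zero>" "triprod L p ?x (y \<ominus> ?y) = \<zero>"
    using assms by (simp_all add: central_prod)
  then have "triprod L p x y \<ominus> triprod L p ?x y = \<zero>"
    "triprod L p ?x y \<ominus> triprod L p ?x ?y = \<zero>"
    using assms by (simp_all add: prod_minus_left prod_minus_right)
  then show ?thesis
    using assms by (simp add: L.M.minus_eq_zero_iff)
qed

lemma section_cocycle_coset:
  assumes "x \<in> carrier L" "y \<in> carrier L"
  shows "section_cocycle L Z \<mu> p (Z +> x) (Z +> y) = retraction (triprod L p x y)"
  using assms by (simp add: section_cocycle_def retraction_def prod_section prod_coset)

lemma section_cocycle_eq:
  assumes "X \<in> carrier Q" "Y \<in> carrier Q"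
  shows "section_cocycle L Z \<mu> p X Y = retraction (triprod L p (\<mu> X) (\<mu> Y))"
  using section_cocycle_coset[of "\<mu> X" "\<mu> Y"] assms by (simp add: coset_section)

text \<open>By \<open>section_cocycle_eq\<close> the map is \<mu> in both arguments, then the
  product of \<open>L\<close>, then \<open>retraction\<close>. The last map lands in
  \<open>Z\<close>, so the target is \<open>LZ\<close>.\<close>

lemma bilinear_section_cocycle: "bilinear_map F Q LZ (section_cocycle L Z \<mu> p)"
  by (rule bilinear_map_cong[OF bilinear_map_comp_left[OF
        bilinear_map_comp_right[OF bilinear sec.linear_map_axioms] linear_map_retraction]])
    (rule section_cocycle_eq)

lemma module_LZ: "module F LZ"
  using submodule.submodule_is_module[OF submodule] L.module_axioms by blast

lemma prod_mem_Z: "\<lbrakk>x \<in> Z; y \<in> Z\<rbrakk> \<Longrightarrow> triprod L p x y \<in> Z"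
  using central_prod[of x y p] Z_subset U.zero_closed by simp

text \<open>Products in the central ideal are zero, so a linear map kills them
  automatically.\<close>

lemma HZ_iff: "\<chi> \<in> carrier HZ \<longleftrightarrow> \<chi> \<in> extensional Z \<and> linear_map F LZ A \<chi>"
proof
  assume \<chi>: "\<chi> \<in> extensional Z \<and> linear_map F LZ A \<chi>"
  then have "\<chi> \<zero> = \<zero>\<^bsub>A\<^esub>"
    using linear_map.map_zero[of F LZ A \<chi>] by simp
  with \<chi> show "\<chi> \<in> carrier HZ"
    by (simp add: Hom_space_carrier_iff central_prod Z_subset)
qed (simp add: Hom_space_carrier_iff)

sublocale HQ: module F HQ
  by (rule module_Hom_space[OF module_Q A.module_axioms Q.prod_closed])

sublocale HL: module F HL
  by (rule module_Hom_space[OF L.module_axioms A.module_axioms prod_closed])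

sublocale HZ: module F HZ
  by (rule module_Hom_space[OF module_LZ A.module_axioms]) (simp add: prod_mem_Z)

section \<open>Inflation and restriction of homomorphisms\<close>

lemma Inf1_apply: "x \<in> carrier L \<Longrightarrow> Inf1 L Z \<chi> x = \<chi> (Z +> x)"
  by (simp add: Inf1_def compose_def natural_map_def)

lemma Inf1_mem:
  assumes "\<chi> \<in> carrier HQ"
  shows "Inf1 L Z \<chi> \<in> carrier HL"
proof -
  have "linear_map F L A (\<lambda>x. \<chi> (Z +> x))"
    by (rule linear_map_comp[OF linear_map_coset_Q Hom_spaceD(1)[OF assms]])
  then have "(\<lambda>x\<in>carrier L. \<chi> (Z +> x)) \<in> carrier HL"
    by (rule restrict_mem_Hom_spaceI)
      (simp_all add: Hom_spaceD(2)[OF assms] flip: prod_coset)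
  then show ?thesis
    by (simp add: Inf1_def compose_def natural_map_def)
qed

lemma linear_map_Inf1: "linear_map F HQ HL (Inf1 L Z)"
  by (rule linear_mapI)
    (auto intro!: Hom_space_eqI[of _ F L A]
      simp: HQ.module_axioms HL.module_axioms Inf1_mem Inf1_apply Hom_space_apply)

lemma Res_apply: "x \<in> Z \<Longrightarrow> Res Z \<pi> x = \<pi> x"
  by (simp add: Res_def)

lemma Res_mem: "\<pi> \<in> carrier HL \<Longrightarrow> Res Z \<pi> \<in> carrier HZ"
  unfolding HZ_iff Res_def Hom_space_carrier_iff
  by (auto intro: linear_map_cong[OF linear_map_subspace_domain[OF _ submodule]] simp: prod_mem_Z)

lemma linear_map_Res: "linear_map F HL HZ (Res Z)"
  by (rule linear_mapI)
    (auto intro!: Hom_space_eqI[of _ F LZ A]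
      simp: HL.module_axioms HZ.module_axioms Res_mem Res_apply Hom_space_apply Z_subset)

section \<open>The transgression and its representing cocycle\<close>

definition push :: "('l \<Rightarrow> 'a) \<Rightarrow> triop \<Rightarrow> 'l set \<Rightarrow> 'l set \<Rightarrow> 'a" where
  "push \<chi> = (\<lambda>p. \<lambda>X\<in>carrier Q. \<lambda>Y\<in>carrier Q. \<chi> (section_cocycle L Z \<mu> p X Y))"

lemma push_coset:
  "\<lbrakk>x \<in> carrier L; y \<in> carrier L\<rbrakk> \<Longrightarrow>
    push \<chi> p (Z +> x) (Z +> y) = \<chi> (retraction (triprod L p x y))"
  by (simp add: push_def section_cocycle_coset)

lemma push_apply:
  "\<lbrakk>X \<in> carrier Q; Y \<in> carrier Q\<rbrakk> \<Longrightarrow>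
    push \<chi> p X Y = \<chi> (retraction (triprod L p (\<mu> X) (\<mu> Y)))"
  by (simp add: push_def section_cocycle_eq)

text \<open>On cosets both sides of a cocycle identity are \<chi> after \<open>retraction\<close>,
  evaluated at the two sides of an axiom of \<open>L\<close>.\<close>

lemma push_cocycle:
  assumes "\<chi> \<in> carrier HZ"
  shows "push \<chi> \<in> cocycles F Q A"
  unfolding push_def
proof (rule restrict_mem_cocyclesI)
  show "bilinear_map F Q A (\<lambda>X Y. \<chi> (section_cocycle L Z \<mu> p X Y))" for p
    by (rule bilinear_map_comp_left[OF bilinear_section_cocycle Hom_spaceD(1)[OF assms]])
next
  fix p q r s X Y W
  assume rule: "(p, q, r, s) \<in> triass_rules"
    and "X \<in> carrier Q" "Y \<in> carrier Q" "W \<in> carrier Q"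
  then obtain x y w where "x \<in> carrier L" "X = Z +> x" "y \<in> carrier L" "Y = Z +> y"
    "w \<in> carrier L" "W = Z +> w"
    by (auto simp: carrier_Q)
  then show "\<chi> (section_cocycle L Z \<mu> p (triprod Q q X Y) W) =
      \<chi> (section_cocycle L Z \<mu> r X (triprod Q s Y W))"
    by (simp add: prod_coset section_cocycle_coset assoc[OF rule])
qed auto

lemma linear_map_push: "linear_map F HZ (Z2 F Q A) push"
  by (rule linear_mapI)
    (auto intro!: cocycles_eqI[of _ F Q A]
      simp: HZ.module_axioms CQ.module_Z2 push_cocycle Z2_simps(1) Z2_apply push_apply
        CQ.add_cocycle CQ.smult_cocycle Hom_space_apply retraction_mem)

lemma Tra_eq: "Tra F L Z \<mu> A \<chi> = cohomology_class F Q A (push \<chi>)"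
  by (simp add: Tra_def push_def)

lemma linear_map_Tra: "linear_map F HZ (H2 F Q A) (Tra F L Z \<mu> A)"
  unfolding Tra_eq by (rule linear_map_comp[OF linear_map_push CQ.linear_map_cohomology_class])

section \<open>Inflation on second cohomology\<close>

definition inflate :: "(triop \<Rightarrow> 'l set \<Rightarrow> 'l set \<Rightarrow> 'a) \<Rightarrow> triop \<Rightarrow> 'l \<Rightarrow> 'l \<Rightarrow> 'a" where
  "inflate f = (\<lambda>p. \<lambda>x\<in>carrier L. \<lambda>y\<in>carrier L. f p (Z +> x) (Z +> y))"

lemma inflate_apply:
  "\<lbrakk>x \<in> carrier L; y \<in> carrier L\<rbrakk> \<Longrightarrow> inflate f p x y = f p (Z +> x) (Z +> y)"
  by (simp add: inflate_def)

lemma inflate_cocycle: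
  assumes "f \<in> cocycles F Q A"
  shows "inflate f \<in> cocycles F L A"
  unfolding inflate_def
proof (rule restrict_mem_cocyclesI)
  show "bilinear_map F L A (\<lambda>x y. f p (Z +> x) (Z +> y))" for p
    by (rule bilinear_map_comp_right[OF cocyclesD(1)[OF assms] linear_map_coset_Q])
next
  fix p q r s x y z
  assume "(p, q, r, s) \<in> triass_rules" "x \<in> carrier L" "y \<in> carrier L" "z \<in> carrier L"
  then show "f p (Z +> triprod L q x y) (Z +> z) = f r (Z +> x) (Z +> triprod L s y z)"
    using cocyclesD(2)[OF assms] by (simp flip: prod_coset)
qed auto

lemma linear_map_inflate: "linear_map F (Z2 F Q A) (Z2 F L A) inflate"
  by (rule linear_mapI)
    (auto intro!: cocycles_eqI[of _ F L A]
      simp: CQ.module_Z2 CL.module_Z2 inflate_cocycle Z2_simps(1) Z2_apply inflate_apply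
        CQ.add_cocycle CQ.smult_cocycle CL.add_cocycle CL.smult_cocycle)

lemma Inf2_eq: "Inf2 F L Z A C = (\<Union>f\<in>C. cohomology_class F L A (inflate f))"
  by (simp add: Inf2_def inflate_def natural_map_def)

lemma linear_map_class_inflate:
  "linear_map F (Z2 F Q A) (H2 F L A) (\<lambda>f. cohomology_class F L A (inflate f))"
  by (rule linear_map_comp[OF linear_map_inflate CL.linear_map_cohomology_class])

text \<open>The inflation of the coboundary of \<epsilon> is the coboundary of \<epsilon> composed
  with the coset map. This makes \<open>Inf2\<close> well defined on classes.\<close>

lemma class_inflate_B2:
  assumes "f \<in> B2 F Q A"
  shows "cohomology_class F L A (inflate f) = \<zero>\<^bsub>H2 F L A\<^esub>"
proof -
  obtain \<epsilon> where f: "f \<in> cocycles F Q A" and \<epsilon>: "linear_map F Q A \<epsilon>"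
    and eq: "\<And>p X Y. \<lbrakk>X \<in> carrier Q; Y \<in> carrier Q\<rbrakk> \<Longrightarrow> f p X Y = \<ominus>\<^bsub>A\<^esub> \<epsilon> (triprod Q p X Y)"
    using assms unfolding CQ.B2_iff by blast
  show ?thesis
    unfolding CL.cohomology_class_eq_zero_iff[OF inflate_cocycle[OF f]]
    using linear_map_comp[OF linear_map_coset_Q \<epsilon>]
    by (intro exI[of _ "\<lambda>x. \<epsilon> (Z +> x)"]) (simp add: inflate_apply eq prod_coset)
qed

text \<open>\<open>Inf2\<close> is the lift of
  \<open>f \<mapsto> cohomology_class F L A (inflate f)\<close> to the quotient by
  \<open>B2 F Q A\<close>. Only the source \<open>H2 F Q A\<close> is unfolded, to expose that
  quotient.\<close>

lemma linear_map_Inf2: "linear_map F (H2 F Q A) (H2 F L A) (Inf2 F L Z A)"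
  unfolding Inf2_eq[abs_def] H2_def[of F Q A]
  by (rule CQ.H2.linear_map_lift[OF linear_map_class_inflate class_inflate_B2])

lemma Inf2_class:
  "f \<in> cocycles F Q A \<Longrightarrow>
    Inf2 F L Z A (cohomology_class F Q A f) = cohomology_class F L A (inflate f)"
  unfolding Inf2_eq cohomology_class_def[of F Q A]
  using CQ.H2.lift_coset[OF linear_map_class_inflate class_inflate_B2]
  by (simp add: Z2_simps(1))

section \<open>Exactness at the four inner terms\<close>

lemma exact_at_HQ:
  "exact_at F zero_space (\<lambda>_. \<zero>\<^bsub>HQ\<^esub>) HQ (Inf1 L Z) HL"
proof -
  interpret inf: linear_map F HQ HL "Inf1 L Z"
    by (rule linear_map_Inf1)
  have "module F (zero_space :: ('f, unit) module)"
    by (intro moduleI abelian_groupI) (simp_all add: zero_space_def is_cring)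
  then have "linear_map F zero_space HQ (\<lambda>_. \<zero>\<^bsub>HQ\<^esub>)"
    by (rule linear_map_zero) (rule HQ.module_axioms)
  \<comment> \<open>The coset map is onto, so the values of \<open>Inf1 L Z \<chi>\<close> are all
    the values of \<chi>.\<close>
  moreover have inj: "\<chi> = \<zero>\<^bsub>HQ\<^esub>" if \<chi>: "\<chi> \<in> carrier HQ" and ker: "Inf1 L Z \<chi> = \<zero>\<^bsub>HL\<^esub>" for \<chi>
  proof (rule Hom_space_eqI[OF \<chi> HQ.M.zero_closed])
    fix X assume X: "X \<in> carrier Q"
    then obtain x where x: "x \<in> carrier L" "X = Z +> x"
      by (auto simp: carrier_Q)
    then show "\<chi> X = \<zero>\<^bsub>HQ\<^esub> X"
      using X Inf1_apply[of x \<chi>] by (simp add: ker Hom_space_apply)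
  qed
  moreover have "a_kernel HQ HL (Inf1 L Z) = {\<zero>\<^bsub>HQ\<^esub>}"
    unfolding a_kernel_def' using inj inf.map_zero by blast
  ultimately show ?thesis
    by (simp add: exact_at_def inf.linear_map_axioms zero_space_def)
qed

lemma exact_at_HL: "exact_at F HQ (Inf1 L Z) HL (Res Z) HZ"
  unfolding exact_at_def
proof (intro conjI linear_map_Inf1 linear_map_Res subset_antisym subsetI)
  fix \<pi> assume "\<pi> \<in> Inf1 L Z ` carrier HQ"
  then obtain \<chi> where \<chi>: "\<chi> \<in> carrier HQ" and \<pi>: "\<pi> = Inf1 L Z \<chi>"
    by blast
  interpret \<chi>: linear_map F Q A \<chi>
    by (rule Hom_spaceD(1)[OF \<chi>])
  \<comment> \<open>The coset of an element of \<open>Z\<close> is the zero of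
    \<open>Q\<close>.\<close>
  have "\<chi> (Z +> z) = \<zero>\<^bsub>A\<^esub>" if "z \<in> Z" for z
    using that \<chi>.map_zero by (simp add: U.a_rcos_const triass_quotient_simps quotient_space_def)
  then have "Res Z \<pi> = \<zero>\<^bsub>HZ\<^esub>"
    unfolding \<pi> by (intro Hom_space_eqI[OF Res_mem[OF Inf1_mem[OF \<chi>]] HZ.M.zero_closed])
      (simp add: Res_apply Inf1_apply Hom_space_apply Z_subset)
  then show "\<pi> \<in> a_kernel HL HZ (Res Z)"
    by (simp add: a_kernel_def' \<pi> Inf1_mem[OF \<chi>])
next
  fix \<pi> assume "\<pi> \<in> a_kernel HL HZ (Res Z)"
  then have \<pi>: "\<pi> \<in> carrier HL" and ker: "Res Z \<pi> = \<zero>\<^bsub>HZ\<^esub>"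
    by (simp_all add: a_kernel_def')
  interpret \<pi>: linear_map F L A \<pi>
    by (rule Hom_spaceD(1)[OF \<pi>])
  have \<pi>Z: "\<pi> z = \<zero>\<^bsub>A\<^esub>" if "z \<in> Z" for z
    using that Res_apply[of z \<pi>] by (simp add: ker Hom_space_apply)
  \<comment> \<open>The two arguments differ by \<open>retraction x\<close>, an element of
    \<open>Z\<close>, where \<pi> vanishes. Hence composing \<pi> with \<mu> inverts the inflation,
    and it kills products because \<pi> does.\<close>
  have \<pi>\<mu>: "\<pi> (\<mu> (Z +> x)) = \<pi> x" if x: "x \<in> carrier L" for x
    using \<pi>Z[OF retraction_mem[OF x]] x
    by (simp add: retraction_def \<pi>.map_minus A.M.minus_eq_zero_iff)
  define \<chi> where "\<chi> = (\<lambda>X\<in>carrier Q. \<pi> (\<mu> X))"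
  have \<chi>: "\<chi> \<in> carrier HQ"
    unfolding \<chi>_def
  proof (rule restrict_mem_Hom_spaceI)
    show "linear_map F Q A (\<lambda>X. \<pi> (\<mu> X))"
      by (rule linear_map_comp[OF sec.linear_map_axioms \<pi>.linear_map_axioms])
  qed (use \<pi> in \<open>auto simp: carrier_Q prod_coset \<pi>\<mu> Hom_space_carrier_iff\<close>)
  moreover have "Inf1 L Z \<chi> = \<pi>"
    by (rule Hom_space_eqI[OF Inf1_mem[OF \<chi>] \<pi>]) (simp add: Inf1_apply \<chi>_def \<pi>\<mu>)
  ultimately show "\<pi> \<in> Inf1 L Z ` carrier HQ"
    by blast
qed

lemma exact_at_HZ: "exact_at F HL (Res Z) HZ (Tra F L Z \<mu> A) (H2 F Q A)"
  unfolding exact_at_def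
proof (intro conjI linear_map_Res linear_map_Tra subset_antisym subsetI)
  fix \<chi> assume "\<chi> \<in> Res Z ` carrier HL"
  then obtain \<pi> where \<pi>: "\<pi> \<in> carrier HL" and \<chi>: "\<chi> = Res Z \<pi>"
    by blast
  interpret \<pi>: linear_map F L A \<pi>
    by (rule Hom_spaceD(1)[OF \<pi>])
  have mem: "\<chi> \<in> carrier HZ"
    using Res_mem[OF \<pi>] by (simp add: \<chi>)
  have "linear_map F Q A (\<lambda>X. \<pi> (\<mu> X))"
    by (rule linear_map_comp[OF sec.linear_map_axioms \<pi>.linear_map_axioms])
  \<comment> \<open>With \<chi> the restriction of \<pi>, the cocycle is \<pi> at
    \<open>x * y - \<mu> (Z +> x * y)\<close>. The first term drops out since \<pi> kills products,
    leaving the coboundary of \<pi> after \<mu>.\<close>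
  moreover have "push \<chi> p X Y = \<ominus>\<^bsub>A\<^esub> \<pi> (\<mu> (triprod Q p X Y))"
    if XY: "X \<in> carrier Q" "Y \<in> carrier Q" for p X Y
  proof -
    obtain x y where "x \<in> carrier L" "X = Z +> x" "y \<in> carrier L" "Y = Z +> y"
      using XY by (auto simp: carrier_Q)
    then show ?thesis
      using \<pi> by (simp add: push_coset \<chi> Res_apply retraction_mem prod_coset)
        (simp add: retraction_def \<pi>.map_minus a_minus_def Hom_space_carrier_iff)
  qed
  ultimately have "Tra F L Z \<mu> A \<chi> = \<zero>\<^bsub>H2 F Q A\<^esub>"
    unfolding Tra_eq CQ.cohomology_class_eq_zero_iff[OF push_cocycle[OF mem]] by blast
  then show "\<chi> \<in> a_kernel HZ (H2 F Q A) (Tra F L Z \<mu> A)"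
    by (simp add: a_kernel_def' mem)
next
  fix \<chi> assume "\<chi> \<in> a_kernel HZ (H2 F Q A) (Tra F L Z \<mu> A)"
  then have mem: "\<chi> \<in> carrier HZ" and "Tra F L Z \<mu> A \<chi> = \<zero>\<^bsub>H2 F Q A\<^esub>"
    by (simp_all add: a_kernel_def')
  then obtain \<epsilon> where "linear_map F Q A \<epsilon>"
    and eq: "\<And>p X Y. \<lbrakk>X \<in> carrier Q; Y \<in> carrier Q\<rbrakk> \<Longrightarrow>
      push \<chi> p X Y = \<ominus>\<^bsub>A\<^esub> \<epsilon> (triprod Q p X Y)"
    unfolding Tra_eq CQ.cohomology_class_eq_zero_iff[OF push_cocycle[OF mem]] by blast
  then interpret \<epsilon>: linear_map F Q A \<epsilon> by blast
  have lin\<chi>: "linear_map F LZ A \<chi>"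
    by (rule Hom_spaceD(1)[OF mem])
  \<comment> \<open>Extending \<chi> along the retraction is linear but need not kill products: at
    \<open>x * y\<close> it gives the value of \<open>push \<chi>\<close>. The \<epsilon> summand
    cancels just this, and it vanishes on \<open>Z\<close>, where \<open>retraction\<close> is the
    identity.\<close>
  define \<pi> where "\<pi> = (\<lambda>x\<in>carrier L. \<chi> (retraction x) \<oplus>\<^bsub>A\<^esub> \<epsilon> (Z +> x))"
  have "\<pi> \<in> carrier HL"
    unfolding \<pi>_def
  proof (rule restrict_mem_Hom_spaceI)
    show "linear_map F L A (\<lambda>x. \<chi> (retraction x) \<oplus>\<^bsub>A\<^esub> \<epsilon> (Z +> x))"
      by (intro linear_map_add linear_map_comp[OF linear_map_retraction lin\<chi>]
          linear_map_comp[OF linear_map_coset_Q \<epsilon>.linear_map_axioms])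
    fix p x y assume "x \<in> carrier L" "y \<in> carrier L"
    then show "\<chi> (retraction (triprod L p x y)) \<oplus>\<^bsub>A\<^esub> \<epsilon> (Z +> triprod L p x y) = \<zero>\<^bsub>A\<^esub>"
      using eq[of "Z +> x" "Z +> y" p] by (simp add: push_coset prod_coset A.M.l_neg)
  qed simp
  moreover have "Res Z \<pi> = \<chi>"
  proof (rule Hom_space_eqI[OF Res_mem mem])
    fix z assume "z \<in> carrier LZ"
    then have z: "z \<in> Z" by simp
    have "\<epsilon> (Z +> z) = \<zero>\<^bsub>A\<^esub>"
      using z \<epsilon>.map_zero by (simp add: U.a_rcos_const triass_quotient_simps quotient_space_def)
    then show "Res Z \<pi> z = \<chi> z"
      using z Hom_space_closed[OF mem]
      by (simp add: Res_apply \<pi>_def Z_subset retraction_central)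
  qed fact
  ultimately show "\<chi> \<in> Res Z ` carrier HL"
    by blast
qed

lemma exact_at_H2: "exact_at F HZ (Tra F L Z \<mu> A) (H2 F Q A) (Inf2 F L Z A) (H2 F L A)"
  unfolding exact_at_def
proof (intro conjI linear_map_Tra linear_map_Inf2 subset_antisym subsetI)
  interpret tra: linear_map F HZ "H2 F Q A" "Tra F L Z \<mu> A"
    by (rule linear_map_Tra)
  fix C assume "C \<in> Tra F L Z \<mu> A ` carrier HZ"
  then obtain \<chi> where mem: "\<chi> \<in> carrier HZ" and C: "C = Tra F L Z \<mu> A \<chi>"
    by blast
  have lin\<chi>: "linear_map F LZ A \<chi>"
    by (rule Hom_spaceD(1)[OF mem])
  \<comment> \<open>Inflating \<open>push \<chi>\<close> gives \<chi> after
    \<open>retraction\<close> at \<open>x * y\<close>, and the negative of that map is defined on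
    all of \<open>L\<close>; the sign matches the convention in \<open>B2\<close>.\<close>
  have "linear_map F L A (\<lambda>x. \<ominus>\<^bsub>A\<^esub> \<chi> (retraction x))"
    by (intro linear_map_neg linear_map_comp[OF linear_map_retraction lin\<chi>])
  moreover have "\<forall>p. \<forall>x\<in>carrier L. \<forall>y\<in>carrier L.
      inflate (push \<chi>) p x y = \<ominus>\<^bsub>A\<^esub> (\<ominus>\<^bsub>A\<^esub> \<chi> (retraction (triprod L p x y)))"
    using Hom_space_closed[OF mem] by (simp add: inflate_apply push_coset retraction_mem)
  ultimately have "cohomology_class F L A (inflate (push \<chi>)) = \<zero>\<^bsub>H2 F L A\<^esub>"
    using CL.cohomology_class_eq_zero_iff[OF inflate_cocycle[OF push_cocycle[OF mem]]]
    by blast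
  then have "Inf2 F L Z A C = \<zero>\<^bsub>H2 F L A\<^esub>"
    by (simp only: C Tra_eq Inf2_class[OF push_cocycle[OF mem]])
  then show "C \<in> a_kernel (H2 F Q A) (H2 F L A) (Inf2 F L Z A)"
    unfolding a_kernel_def' C using tra.closed[OF mem] by blast
next
  fix C assume "C \<in> a_kernel (H2 F Q A) (H2 F L A) (Inf2 F L Z A)"
  then have "C \<in> carrier (H2 F Q A)" and ker: "Inf2 F L Z A C = \<zero>\<^bsub>H2 F L A\<^esub>"
    by (simp_all add: a_kernel_def')
  then obtain f where f: "f \<in> cocycles F Q A" and C: "C = cohomology_class F Q A f"
    by (auto simp: CQ.carrier_H2)
  obtain \<epsilon> where "linear_map F L A \<epsilon>"
    and eq: "\<And>p x y. \<lbrakk>x \<in> carrier L; y \<in> carrier L\<rbrakk> \<Longrightarrow>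
      inflate f p x y = \<ominus>\<^bsub>A\<^esub> \<epsilon> (triprod L p x y)"
    using ker unfolding C Inf2_class[OF f]
      CL.cohomology_class_eq_zero_iff[OF inflate_cocycle[OF f]] by blast
  then interpret \<epsilon>: linear_map F L A \<epsilon> by blast
  \<comment> \<open>The sign is chosen so that \<open>push \<chi>\<close> contains the term
    \<open>-\<epsilon> (x * y)\<close>, which is the value of \<open>f\<close> at the cosets of
    \<open>x\<close> and \<open>y\<close>.\<close>
  define \<chi> where "\<chi> = (\<lambda>z\<in>Z. \<ominus>\<^bsub>A\<^esub> \<epsilon> z)"
  have "linear_map F LZ A (\<lambda>z. \<ominus>\<^bsub>A\<^esub> \<epsilon> z)"
    by (intro linear_map_neg linear_map_subspace_domain[OF \<epsilon>.linear_map_axioms submodule])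
  then have mem: "\<chi> \<in> carrier HZ"
    unfolding HZ_iff \<chi>_def by (auto elim: linear_map_cong)
  have "linear_map F Q A (\<lambda>X. \<ominus>\<^bsub>A\<^esub> \<epsilon> (\<mu> X))"
    by (intro linear_map_neg linear_map_comp[OF sec.linear_map_axioms \<epsilon>.linear_map_axioms])
  \<comment> \<open>Since \<open>push \<chi>\<close> is
    \<open>-\<epsilon> (x * y) + \<epsilon> (\<mu> (Z +> x * y))\<close>, subtracting
    \<open>f\<close> leaves the second term. It depends only on the product in \<open>Q\<close>, so
    it is the coboundary of the negative of \<epsilon> after \<mu>.\<close>
  moreover have "push \<chi> p X Y \<ominus>\<^bsub>A\<^esub> f p X Y = \<ominus>\<^bsub>A\<^esub> (\<ominus>\<^bsub>A\<^esub> \<epsilon> (\<mu> (triprod Q p X Y)))"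
    if XY: "X \<in> carrier Q" "Y \<in> carrier Q" for p X Y
  proof -
    obtain x y where xy: "x \<in> carrier L" "X = Z +> x" "y \<in> carrier L" "Y = Z +> y"
      using XY by (auto simp: carrier_Q)
    have "f p X Y = \<ominus>\<^bsub>A\<^esub> \<epsilon> (triprod L p x y)"
      using eq[of x y p] xy by (simp add: inflate_apply)
    then show ?thesis
      using xy by (simp add: push_coset \<chi>_def retraction_mem prod_coset)
        (simp add: retraction_def \<epsilon>.map_minus a_minus_def A.M.minus_add A.M.a_ac A.M.r_neg2)
  qed
  ultimately have "Tra F L Z \<mu> A \<chi> = C"
    unfolding Tra_eq C CQ.cohomology_class_eq_iff[OF push_cocycle[OF mem] f]
    by (intro exI[of _ "\<lambda>X. \<ominus>\<^bsub>A\<^esub> \<epsilon> (\<mu> X)"]) simp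
  then show "C \<in> Tra F L Z \<mu> A ` carrier HZ"
    using mem by blast
qed

end

text \<open>Exactness after the map out of \<open>zero_space\<close> expresses the injectivity of
  \<open>Inf1\<close>. The sequence does not continue past \<open>H2 F L A\<close>, so there are
  four exactness claims.\<close>

theorem theorem4p1:
  fixes F :: "('f, 'k) ring_scheme" and L :: "('f, 'l) triass" and Z :: "'l set"
    and \<mu> :: "'l set \<Rightarrow> 'l" and A :: "('f, 'a) module"
  assumes "field F"
    and "triassociative_algebra F L"
    and "central_ideal F L Z"
    and "is_section F L Z \<mu>"
    and "module F A"
  shows "exact_at F zero_space (\<lambda>_. \<zero>\<^bsub>Hom_space F (triass_quotient L Z) A\<^esub>)
           (Hom_space F (triass_quotient L Z) A) (Inf1 L Z) (Hom_space F L A)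
       \<and> exact_at F (Hom_space F (triass_quotient L Z) A) (Inf1 L Z)
           (Hom_space F L A) (Res Z) (Hom_space F (L\<lparr>carrier := Z\<rparr>) A)
       \<and> exact_at F (Hom_space F L A) (Res Z)
           (Hom_space F (L\<lparr>carrier := Z\<rparr>) A) (Tra F L Z \<mu> A) (H2 F (triass_quotient L Z) A)
       \<and> exact_at F (Hom_space F (L\<lparr>carrier := Z\<rparr>) A) (Tra F L Z \<mu> A)
           (H2 F (triass_quotient L Z) A) (Inf2 F L Z A) (H2 F L A)"
proof -
  interpret central_extension F L A Z \<mu>
    using assms by (simp add: central_extension_def central_extension_axioms_def)
  show ?thesis
    using exact_at_HQ exact_at_HL exact_at_HZ exact_at_H2 by blast
qed

end
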